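(* Let $n\ge 2$ and $1\le k\le n-1$, and let $T\subset\mathbb R^n$ be a nondegenerate $n$-simplex with barycentric coordinates $\lambda_0,\dots,\lambda_n$. For $\sigma\in\Sigma(0:n-k,0:n)$ and $i\in\{1,\dots,n-k\}$ put $$\phi_{\sigma,i}:=\mathrm d\lambda_{\sigma^*}\otimes \mathrm d\lambda_{[\sigma(0),\sigma(i)]^*},\qquad \psi_{\sigma,i}:=P_{\mathbb X}\big(\star\,\mathrm d\lambda_{\sigma-\sigma(i)}\otimes\star\,\mathrm d\lambda_{\sigma(i)}\big).$$ Then the set $\{\phi_{\sigma,i}\}$, where $\sigma$ runs over $\Sigma(0:n-k,0:n)$ and $i$ over $1,\dots,n-k$, is a basis of $\mathbb X$. Its dual basis is, up to rescaling each element by a nonzero constant, the set $\{\psi_{\sigma,i}\}$; that is, $\{\psi_{\sigma,i}\}$ is a basis of $\mathbb X$ and, for all $\sigma,\tau\in\Sigma(0:n-k,0:n)$ and $i,j\in\{1,\dots,n-k\}$, $\langle\phi_{\sigma,i},\psi_{\tau,j}\rangle\neq 0$ if and only if $\sigma=\tau$ and $i=j$.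
   Context: $\mathrm{Alt}^j$ is the space of alternating $j$-linear forms on $\mathbb R^n$, and $\mathrm{Alt}^{k,n-1}=\mathrm{Alt}^k\otimes\mathrm{Alt}^{n-1}$, $\mathrm{Alt}^{k-1,n}=\mathrm{Alt}^{k-1}\otimes\mathrm{Alt}^n$. The linear map $s^{k,n-1}:\mathrm{Alt}^{k,n-1}\to\mathrm{Alt}^{k-1,n}$ is $$s^{k,n-1}\omega(w_1,\dots,w_{k-1})(v_1,\dots,v_n)=\sum_{i=1}^n(-1)^{i-1}\omega(v_i,w_1,\dots,w_{k-1})(v_1,\dots,\widehat{v_i},\dots,v_n),$$ and $\mathbb X:=\ker(s^{k,n-1})\subset\mathrm{Alt}^{k,n-1}$. The inner product on $\mathrm{Alt}^j$ is $\langle\omega,\eta\rangle=\sum_{\sigma}\omega(e_{\sigma(1)},\dots,e_{\sigma(j)})\,\eta(e_{\sigma(1)},\dots,e_{\sigma(j)})$, the sum being over increasing sequences $\sigma$ of length $j$ in $\{1,\dots,n\}$ and $(e_i)$ being any orthonormal basis of $\mathbb R^n$; it is extended to $\mathrm{Alt}^{k,n-1}$ by tensor product. $P_{\mathbb X}$ is the orthogonal projection of $\mathrm{Alt}^{k,n-1}$ onto $\mathbb X$. $\star$ is the Hodge star, $\omega\wedge\star\eta=\langle\omega,\eta\rangle\,\mathrm dx_1\wedge\dots\wedge \mathrm dx_n$. $\Sigma(0:n-k,0:n)$ is the set of strictly increasing maps $\sigma:\{0,\dots,n-k\}\to\{0,\dots,n\}$, identified with their ranges. $\sigma^*=\{0,\dots,n\}\setminus\sigma$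 (of size $k$), and $\sigma-\sigma(i)$ is the set $\sigma$ with $\sigma(i)$ removed. For a subset $S\subseteq\{0,\dots,n\}$, $\mathrm d\lambda_S$ is the wedge product of the (constant) 1-forms $\mathrm d\lambda_j$, $j\in S$, in increasing order. In particular $\mathrm d\lambda_{[\sigma(0),\sigma(i)]^*}=\mathrm d\lambda_0\wedge\cdots\wedge\widehat{\mathrm d\lambda}_{\sigma(0)}\wedge\cdots\wedge\widehat{\mathrm d\lambda}_{\sigma(i)}\wedge\cdots\wedge \mathrm d\lambda_n\in\mathrm{Alt}^{n-1}$ (hats denote omitted factors). *)

theory Defs
  imports "HOL-Analysis.Analysis" "HOL-Library.Function_Algebras"
    "HOL-Combinatorics.Permutations"
begin

text \<open>Forms are functions on lists of vectors, so spaces of forms are subspaces of a function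
  type; with this instance \<^const>\<open>span\<close> and \<^term>\<open>independent\<close> apply to them.\<close>

instantiation "fun" :: (type, real_vector) real_vector
begin

definition scaleR_fun :: "real \<Rightarrow> ('a \<Rightarrow> 'b) \<Rightarrow> 'a \<Rightarrow> 'b"
  where "scaleR_fun c f = (\<lambda>x. c *\<^sub>R f x)"

instance
  by standard (simp_all add: scaleR_fun_def fun_eq_iff scaleR_add_right scaleR_add_left)

end

definition is_basis_of :: "'a::real_vector set \<Rightarrow> 'a set \<Rightarrow> bool"
  where "is_basis_of B V \<longleftrightarrow> independent B \<and> span B = V"


section \<open>Alternating forms\<close>

type_synonym 'v form = "'v list \<Rightarrow> real"
type_synonym 'v biform = "'v list \<Rightarrow> 'v list \<Rightarrow> real"

text \<open>A \<open>j\<close>-form takes lists of length \<open>j\<close>. It is set to \<open>0\<close> on lists of any other length, so that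
  equality of forms is equality of functions.\<close>

definition Alt :: "nat \<Rightarrow> 'v::real_vector form set" where
  "Alt j = {f. (\<forall>vs. length vs \<noteq> j \<longrightarrow> f vs = 0)
    \<and> (\<forall>vs i. length vs = j \<and> i < j \<longrightarrow> linear (\<lambda>x. f (vs[i := x])))
    \<and> (\<forall>vs i l. length vs = j \<and> i < l \<and> l < j \<and> vs ! i = vs ! l \<longrightarrow> f vs = 0)}"

definition covector :: "('v \<Rightarrow> real) \<Rightarrow> 'v form"
  where "covector f vs = (case vs of [v] \<Rightarrow> f v | _ \<Rightarrow> 0)"

text \<open>The normalisation is the one for which a wedge of \<open>1\<close>-forms is the determinant of the matrix
  of their values, without factorials.\<close>

definition wedge :: "nat \<Rightarrow> nat \<Rightarrow> 'v form \<Rightarrow> 'v form \<Rightarrow> 'v form" where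
  "wedge j m \<alpha> \<beta> vs =
    (if length vs = j + m
     then (\<Sum>p | p permutes {..<j+m}.
             of_int (sign p) * \<alpha> (map (\<lambda>i. vs ! p i) [0..<j])
                             * \<beta> (map (\<lambda>i. vs ! p i) [j..<j+m])) / (fact j * fact m)
     else 0)"

fun wedge_list :: "'v form list \<Rightarrow> 'v form" where
  "wedge_list [] = (\<lambda>vs. if vs = [] then 1 else 0)"
| "wedge_list (\<alpha> # \<alpha>s) = wedge 1 (length \<alpha>s) \<alpha> (wedge_list \<alpha>s)"


section \<open>Inner product and Hodge star\<close>

text \<open>\<open>\<real>\<^sup>n\<close> is \<open>real^'n\<close>. The linear order on the index type numbers the
  coordinates; it fixes the increasing sequences and the orientation.\<close>

definition increasing_seqs :: "nat \<Rightarrow> 'n::linorder list set"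
  where "increasing_seqs j = {is. length is = j \<and> sorted_wrt (<) is}"

abbreviation unit_vec :: "'n::finite \<Rightarrow> real^'n"
  where "unit_vec i \<equiv> axis i 1"

definition form_inner ::
  "nat \<Rightarrow> (real^('n::{finite,linorder})) form \<Rightarrow> (real^'n::_) form \<Rightarrow> real" where
  "form_inner j \<omega> \<eta> =
    (\<Sum>is\<in>increasing_seqs j. \<omega> (map unit_vec is) * \<eta> (map unit_vec is))"

definition volume_form :: "(real^('n::{finite,linorder})) form" where
  "volume_form =
    wedge_list (map (\<lambda>i. covector (\<lambda>v. v $ i)) (sorted_list_of_set (UNIV :: 'n set)))"

definition hodge_star ::
  "nat \<Rightarrow> (real^('n::{finite,linorder})) form \<Rightarrow> (real^'n::_) form" where
  "hodge_star j \<eta> = (THE \<theta>. \<theta> \<in> Alt (CARD('n) - j) \<and>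
    (\<forall>\<omega>\<in>Alt j. wedge j (CARD('n) - j) \<omega> \<theta> = form_inner j \<omega> \<eta> *\<^sub>R volume_form))"


section \<open>Double forms\<close>

text \<open>The first list holds the arguments of the left tensor factor.\<close>

definition tensor :: "'v form \<Rightarrow> 'v form \<Rightarrow> 'v biform"
  where "tensor \<alpha> \<beta> = (\<lambda>ws vs. \<alpha> ws * \<beta> vs)"

definition Alt2 :: "nat \<Rightarrow> nat \<Rightarrow> 'v::real_vector biform set"
  where "Alt2 j m = span {tensor \<alpha> \<beta> | \<alpha> \<beta>. \<alpha> \<in> Alt j \<and> \<beta> \<in> Alt m}"

definition biform_inner ::
  "nat \<Rightarrow> nat \<Rightarrow> (real^('n::{finite,linorder})) biform \<Rightarrow> (real^'n::_) biform \<Rightarrow> real" where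
  "biform_inner j m \<omega> \<eta> = (\<Sum>is\<in>increasing_seqs j. \<Sum>ls\<in>increasing_seqs m.
     \<omega> (map unit_vec is) (map unit_vec ls) * \<eta> (map unit_vec is) (map unit_vec ls))"

lemma biform_inner_tensor:
  "biform_inner j m (tensor \<alpha> \<beta>) (tensor \<alpha>' \<beta>') = form_inner j \<alpha> \<alpha>' * form_inner m \<beta> \<beta>'"
  by (simp add: biform_inner_def form_inner_def tensor_def sum_product mult_ac)

text \<open>Since forms vanish on lists of the wrong length, no degrees are needed here: on
  \<^term>\<open>Alt2 k (n - 1)\<close> with \<open>k \<ge> 1\<close> and \<open>n \<ge> 1\<close> the result vanishes unless \<open>ws\<close> has length
  \<open>k - 1\<close> and \<open>vs\<close> has length \<open>n\<close>. Positions are counted from \<open>0\<close>, whence the sign \<open>(- 1) ^ i\<close>.\<close>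

definition s_map :: "'v biform \<Rightarrow> 'v biform" where
  "s_map \<omega> ws vs =
    (\<Sum>i<length vs. (- 1) ^ i * \<omega> (vs ! i # ws) (take i vs @ drop (Suc i) vs))"

definition XX :: "nat \<Rightarrow> (real^'n::finite) biform set"
  where "XX k = {\<omega> \<in> Alt2 k (CARD('n) - 1). s_map \<omega> = 0}"

definition proj_XX ::
  "nat \<Rightarrow> (real^('n::{finite,linorder})) biform \<Rightarrow> (real^'n::_) biform" where
  "proj_XX k \<omega> = (THE \<eta>. \<eta> \<in> XX k \<and>
    (\<forall>\<xi>\<in>XX k. biform_inner k (CARD('n) - 1) (\<omega> - \<eta>) \<xi> = 0))"


section \<open>Barycentric coordinates and the two families\<close>

text \<open>These are affine functions on the whole space, not only on the simplex.\<close>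

definition barycentric_coords ::
  "(nat \<Rightarrow> real^'n::finite) \<Rightarrow> (nat \<Rightarrow> real^'n::_ \<Rightarrow> real) \<Rightarrow> bool" where
  "barycentric_coords a lam \<longleftrightarrow>
    (\<forall>x. (\<Sum>j\<le>CARD('n). lam j x) = 1 \<and> (\<Sum>j\<le>CARD('n). lam j x *\<^sub>R a j) = x)"

text \<open>Barycentric coordinates are affine, so their derivative does not depend on the point;
  the origin is an arbitrary choice.\<close>

definition dlam :: "(nat \<Rightarrow> real^'n::finite \<Rightarrow> real) \<Rightarrow> nat set \<Rightarrow> (real^'n::_) form" where
  "dlam lam S =
    wedge_list (map (\<lambda>j. covector (frechet_derivative (lam j) (at 0))) (sorted_list_of_set S))"

text \<open>Extensionality makes equality of these maps equality on \<^term>\<open>{0..r}\<close>.\<close>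

definition Sig :: "nat \<Rightarrow> nat \<Rightarrow> (nat \<Rightarrow> nat) set"
  where "Sig r n = {\<sigma> \<in> {0..r} \<rightarrow>\<^sub>E {0..n}. strict_mono_on {0..r} \<sigma>}"

definition phi ::
  "nat \<Rightarrow> (nat \<Rightarrow> real^'n::finite \<Rightarrow> real) \<Rightarrow> (nat \<Rightarrow> nat) \<Rightarrow> nat \<Rightarrow> (real^'n::_) biform" where
  "phi k lam \<sigma> i =
    tensor (dlam lam ({0..CARD('n)} - \<sigma> ` {0..CARD('n) - k}))
           (dlam lam ({0..CARD('n)} - {\<sigma> 0, \<sigma> i}))"

definition psi ::
  "nat \<Rightarrow> (nat \<Rightarrow> real^('n::{finite,linorder}) \<Rightarrow> real) \<Rightarrow> (nat \<Rightarrow> nat) \<Rightarrow> nat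
    \<Rightarrow> (real^'n::_) biform" where
  "psi k lam \<sigma> i = proj_XX k
    (tensor (hodge_star (CARD('n) - k) (dlam lam (\<sigma> ` {0..CARD('n) - k} - {\<sigma> i})))
            (hodge_star 1 (dlam lam {\<sigma> i})))"

end

theory Submission
  imports Defs "HOL-Combinatorics.Multiset_Permutations"
begin

text \<open>
  Pairing an alternating form with \<open>\<star>d\<lambda>\<^sub>R\<close> amounts, up to a nonzero factor, to evaluating it on edge
  vectors spanning the face whose vertices are those outside \<open>R\<close>. Hence \<open>\<phi>\<close> at \<open>(\<sigma>, i)\<close> has a nonzero
  pairing with the unprojected \<open>\<psi>\<close> at \<open>(\<tau>, j)\<close> exactly if \<open>\<tau> - \<tau>(j)\<close> is contained in \<open>\<sigma>\<close> and \<open>\<tau>(j)\<close> is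
  \<open>\<sigma>(0)\<close> or \<open>\<sigma>(i)\<close>, which forces \<open>\<sigma> = \<tau>\<close> and \<open>i = j\<close>. The projection does not change the pairing,
  because the \<open>\<phi>\<close>'s lie in the kernel of \<open>s\<close>. Linear independence follows.

  Spanning needs no dimension count: an element \<open>\<omega>\<close> of the kernel that annihilates all unprojected
  \<open>\<psi>\<close>'s vanishes. The relation \<open>s \<omega> = 0\<close> supplies the missing index \<open>j = 0\<close>, so \<open>\<omega>\<close> vanishes on every
  pair of a \<open>k\<close>-face \<open>F\<close> and the facet opposite to a vertex \<open>m\<close> of \<open>F\<close>. In the basis of edges issuing from
  one vertex, the component of \<open>\<omega>\<close> at \<open>k\<close> edges with ends \<open>I\<close> and the facet opposite to \<open>m\<close> is zero for
  \<open>m \<in> I\<close> directly, and for \<open>m \<notin> I\<close> by looking at the face \<open>I \<union> {m}\<close>, whose edges at \<open>m\<close> are the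
  differences between the edges to \<open>I\<close> and the edge to \<open>m\<close>.
\<close>

section \<open>Alternating forms and the wedge product\<close>

lemma Alt_length: "f \<in> Alt j \<Longrightarrow> f vs \<noteq> 0 \<Longrightarrow> length vs = j"
  by (auto simp: Alt_def)

lemma Alt_linear_update:
  "f \<in> Alt j \<Longrightarrow> length vs = j \<Longrightarrow> i < j \<Longrightarrow> linear (\<lambda>x. f (vs[i := x]))"
  by (auto simp: Alt_def)

text \<open>Written with a split list, linearity in a slot needs no length condition: on lists of
  any other length the function is constantly zero, hence linear. This form suits the inductions
  over argument lists below.\<close>

lemma Alt_linear:
  assumes "f \<in> Alt j"
  shows "linear (\<lambda>x. f (as @ x # bs))"
proof (cases "length (as @ 0 # bs) = j")
  case True
  then have "linear (\<lambda>x. f ((as @ 0 # bs)[length as := x]))"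
    by (intro Alt_linear_update[OF assms]) auto
  then show ?thesis by simp
next
  case False
  then have "f (as @ x # bs) = 0" for x
    using Alt_length[OF assms, of "as @ x # bs"] by auto
  then show ?thesis by (simp add: linear_iff)
qed

lemma Alt_not_distinct:
  assumes "f \<in> Alt j" "\<not> distinct vs"
  shows "f vs = 0"
proof (cases "length vs = j")
  case True
  obtain i l where il: "i < length vs" "l < length vs" "i \<noteq> l" "vs ! i = vs ! l"
    using assms(2) by (auto simp: distinct_conv_nth)
  have *: "\<And>i l. i < l \<Longrightarrow> l < j \<Longrightarrow> vs ! i = vs ! l \<Longrightarrow> f vs = 0"
    using assms(1) True unfolding Alt_def by blast
  show ?thesis using *[of i l] *[of l i] il True by (cases "i < l") auto
next
  case False
  then show ?thesis using Alt_length[OF assms(1)] by blast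
qed

lemma subspace_Alt: "subspace (Alt j)"
  unfolding subspace_def Alt_def
  by (auto simp: zero_fun_def plus_fun_def scaleR_fun_def linear_iff algebra_simps
      scaleR_add_right)

text \<open>Polarisation: \<open>f\<close> vanishes with \<open>x + y\<close> in both slots, and
  expanding this leaves the two mixed terms.\<close>

lemma Alt_swap:
  assumes "f \<in> Alt j"
  shows "f (as @ x # bs @ y # cs) = - f (as @ y # bs @ x # cs)"
proof -
  have z: "f (as @ z # bs @ z # cs) = 0" for z
    by (rule Alt_not_distinct[OF assms]) auto
  have l: "f (as @ (x + y) # bs @ z # cs) = f (as @ x # bs @ z # cs) + f (as @ y # bs @ z # cs)" for z
    using linear_add[OF Alt_linear[OF assms, of as "bs @ z # cs"]] by simp
  have r: "f (as @ z # bs @ (x + y) # cs) = f (as @ z # bs @ x # cs) + f (as @ z # bs @ y # cs)" for z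
    using linear_add[OF Alt_linear[OF assms, of "as @ z # bs" cs]] by simp
  show ?thesis using z[of "x + y"] z[of x] z[of y] l r by simp
qed

lemma Alt_map_transpose:
  assumes f: "f \<in> Alt j" and "p \<le> a" "a < b" "b < q"
  shows "f (map (x \<circ> Transposition.transpose a b) [p..<q]) = - f (map x [p..<q])"
proof -
  have dec: "[p..<q] = [p..<a] @ a # [Suc a..<b] @ b # [Suc b..<q]"
  proof -
    have "[p..<q] = [p..<a] @ [a..<q]" using assms upt_add_eq_append[of p a "q - a"] by simp
    also have "[a..<q] = a # [Suc a..<q]" using assms by (intro upt_conv_Cons) simp
    also have "[Suc a..<q] = [Suc a..<b] @ [b..<q]" using assms upt_add_eq_append[of "Suc a" b "q - b"] by simp
    also have "[b..<q] = b # [Suc b..<q]" using assms by (intro upt_conv_Cons) simp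
    finally show ?thesis .
  qed
  have id: "map (x \<circ> Transposition.transpose a b) xs = map x xs" if "a \<notin> set xs" "b \<notin> set xs" for xs
    using that by (intro map_cong) (auto simp: Transposition.transpose_def)
  show ?thesis
    unfolding dec using assms(3)
    by (simp add: id Alt_swap[OF f, of _ "x b" _ "x a"] del: map_map)
qed

text \<open>Induction over products of transpositions; quantifying over \<open>x\<close> lets each
  transposition be absorbed into the argument function. The positions form a general interval
  because \<open>wedge_block\<close> applies the rule to the second block as well.\<close>

lemma Alt_permute:
  assumes f: "f \<in> Alt j" and "\<pi> permutes {p..<q}"
  shows "f (map (x \<circ> \<pi>) [p..<q]) = of_int (sign \<pi>) * f (map x [p..<q])"
proof -
  have "\<forall>x. f (map (x \<circ> \<pi>) [p..<q]) = of_int (sign \<pi>) * f (map x [p..<q])"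
    using assms(2) finite_atLeastLessThan
  proof (induction \<pi> rule: permutes_induct)
    case id
    then show ?case by simp
  next
    case (swap a b \<pi>)
    show ?case
    proof
      fix x :: "nat \<Rightarrow> 'a"
      have "f (map (x \<circ> (Transposition.transpose a b \<circ> \<pi>)) [p..<q])
          = of_int (sign \<pi>) * f (map (x \<circ> Transposition.transpose a b) [p..<q])"
        using swap.IH[rule_format, of "x \<circ> Transposition.transpose a b"] by (simp add: o_assoc)
      also have "f (map (x \<circ> Transposition.transpose a b) [p..<q]) = - f (map x [p..<q])"
        using Alt_map_transpose[OF f, of p a b q x] Alt_map_transpose[OF f, of p b a q x] swap.hyps
        by (cases "a < b") (auto simp: transpose_commute)
      also have "sign (Transposition.transpose a b \<circ> \<pi>) = - sign \<pi>"
        using swap.hyps permutes_imp_permutation[OF _ swap.hyps(4)]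
        by (simp add: sign_compose permutation_swap_id sign_swap_id)
      ultimately show "f (map (x \<circ> (Transposition.transpose a b \<circ> \<pi>)) [p..<q])
          = of_int (sign (Transposition.transpose a b \<circ> \<pi>)) * f (map x [p..<q])" by (simp add: comp_def)
    qed
  qed
  then show ?thesis by blast
qed

lemma Alt_permute_list:
  assumes f: "f \<in> Alt j" and "\<pi> permutes {..<length vs}"
  shows "f (permute_list \<pi> vs) = of_int (sign \<pi>) * f vs"
  using Alt_permute[OF f, of \<pi> 0 "length vs" "\<lambda>i. vs ! i"] assms(2)
  by (simp add: permute_list_def map_nth atLeast0LessThan comp_def)

text \<open>Fixing outer arguments is a contraction. It is applied mostly to
  \<open>volume_form\<close>, to produce forms of lower degree.\<close>

lemma Alt_append_middle:
  assumes f: "f \<in> Alt (length as + j + length bs)"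
  shows "(\<lambda>vs. f (as @ vs @ bs)) \<in> Alt j"
  unfolding Alt_def
proof (intro CollectI conjI allI impI)
  fix vs :: "'a list"
  assume "length vs \<noteq> j"
  then show "f (as @ vs @ bs) = 0" using Alt_length[OF f, of "as @ vs @ bs"] by auto
next
  fix vs :: "'a list" and i
  assume "length vs = j \<and> i < j"
  then have "as @ vs[i := x] @ bs = (as @ take i vs) @ x # drop (Suc i) vs @ bs" for x
    by (simp add: upd_conv_take_nth_drop)
  then show "linear (\<lambda>x. f (as @ vs[i := x] @ bs))"
    using Alt_linear[OF f, of "as @ take i vs" "drop (Suc i) vs @ bs"] by simp
next
  fix vs :: "'a list" and i l
  assume *: "length vs = j \<and> i < l \<and> l < j \<and> vs ! i = vs ! l"
  then have "\<not> distinct vs" by (metis distinct_conv_nth less_trans nat_neq_iff)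
  then show "f (as @ vs @ bs) = 0"
    by (intro Alt_not_distinct[OF f]) simp
qed

text \<open>Multilinearity frees the arguments one at a time: the induction lets the prefix
  \<open>us\<close> be arbitrary while the suffix stays in \<open>B\<close>. Lists with repetitions
  are covered by alternation.\<close>

lemma Alt_eq_0_on_span:
  assumes f: "f \<in> Alt j" and B: "span B = UNIV"
    and 0: "\<And>vs. set vs \<subseteq> B \<Longrightarrow> distinct vs \<Longrightarrow> length vs = j \<Longrightarrow> f vs = 0"
  shows "f = 0"
proof -
  have "\<forall>ws. set ws \<subseteq> B \<longrightarrow> f (us @ ws) = 0" for us
  proof (induction us rule: rev_induct)
    case Nil
    then show ?case using 0 Alt_length[OF f] Alt_not_distinct[OF f] by fastforce
  next
    case (snoc x us)
    show ?case
    proof (intro allI impI)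
      fix ws assume ws: "set ws \<subseteq> B"
      have "f (us @ x # ws) = 0"
        by (rule linear_eq_0_on_span[OF Alt_linear[OF f], of B]) (use snoc ws in \<open>auto simp: B\<close>)
      then show "f ((us @ [x]) @ ws) = 0" by simp
    qed
  qed
  from this[rule_format, where ws="[]"] show ?thesis by (auto simp: zero_fun_def)
qed

text \<open>Reordering costs only a sign, so vanishing depends on the multiset of arguments
  alone.\<close>

lemma Alt_mset_cong:
  assumes f: "f \<in> Alt j" and eq: "mset vs = mset ws" and 0: "f vs = 0"
  shows "f ws = 0"
proof -
  obtain \<pi> where "\<pi> permutes {..<length vs}" "permute_list \<pi> vs = ws"
    using mset_eq_permutation[of ws vs] eq by metis
  then show ?thesis using Alt_permute_list[OF f, of \<pi> vs] 0 by simp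
qed

section \<open>Wedge products and their values on dual systems of vectors\<close>

lemma covector_in_Alt: "linear f \<Longrightarrow> covector f \<in> Alt 1"
  unfolding Alt_def covector_def
  by (auto split: list.splits simp: length_Suc_conv less_Suc_eq)

text \<open>Linearity holds summand by summand, because a permutation hands each slot to exactly one
  of the two factors. Alternation comes from pairing \<open>p\<close> with its composite with the
  transposition of the two equal arguments.\<close>

lemma wedge_in_Alt:
  assumes \<alpha>: "\<alpha> \<in> Alt j" and \<beta>: "\<beta> \<in> Alt m"
  shows "wedge j m \<alpha> \<beta> \<in> Alt (j + m)"
proof -
  define t where "t vs p = of_int (sign p) * \<alpha> (map (\<lambda>i. vs ! p i) [0..<j])
      * \<beta> (map (\<lambda>i. vs ! p i) [j..<j+m])" for vs :: "'a list" and p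
  have w: "wedge j m \<alpha> \<beta> vs = (\<Sum>p | p permutes {..<j+m}. t vs p) / (fact j * fact m)"
    if "length vs = j + m" for vs
    using that by (simp add: wedge_def t_def)
  have lin: "linear (\<lambda>x. t (vs[i := x]) p)"
    if vs: "length vs = j + m" and i: "i < j + m" and p: "p permutes {..<j+m}" for vs i p
  proof -
    have pl: "vs[i := x] ! p l = (if p l = i then x else vs ! p l)" if "l < j + m" for x l
      using vs i permutes_in_image[OF p, of l] that by (auto simp: nth_list_update)
    \<comment> \<open>Slot \<open>i\<close> is read at the single position \<open>l\<close>; whether
      \<open>l < j\<close> decides which factor varies with \<open>x\<close>.\<close>
    obtain l where l: "l < j + m" "p l = i"
      using p i by (metis lessThan_iff permutes_inverses(1) permutes_inv permutes_in_image)
    have pi: "p l' = i \<longleftrightarrow> l' = l" for l' using l permutes_inj[OF p] by (auto dest: injD)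
    have upd: "map (\<lambda>l'. if l' = l then x else vs ! p l') [a..<b]
        = (map (\<lambda>l'. vs ! p l') [a..<b])[l - a := x]" if "a \<le> l" "l < b" for a b and x :: 'a
      using that by (intro nth_equalityI) (auto simp: nth_list_update)
    have id: "map (\<lambda>l'. if l' = l then x else vs ! p l') [a..<b] = map (\<lambda>l'. vs ! p l') [a..<b]"
      if "\<not> (a \<le> l \<and> l < b)" for a b and x :: 'a
      using that by (intro nth_equalityI) auto
    have t: "t (vs[i := x]) p = of_int (sign p)
        * \<alpha> (map (\<lambda>l'. if l' = l then x else vs ! p l') [0..<j])
        * \<beta> (map (\<lambda>l'. if l' = l then x else vs ! p l') [j..<j+m])" for x
    proof -
      have "map (\<lambda>l'. vs[i := x] ! p l') [a..<b] = map (\<lambda>l'. if l' = l then x else vs ! p l') [a..<b]"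
        if "b \<le> j + m" for a b
        using that by (intro map_cong) (auto simp: pl pi)
      from this[of j 0] this[of "j+m" j] show ?thesis unfolding t_def by (simp only: le_add1 order_refl)
    qed
    show ?thesis
    proof (cases "l < j")
      case True
      have "linear (\<lambda>x. \<alpha> ((map (\<lambda>l'. vs ! p l') [0..<j])[l := x]))"
        by (rule Alt_linear_update[OF \<alpha>]) (use True in auto)
      then show ?thesis using True unfolding t
        by (simp add: upd[where a=0, simplified] id[of j] linear_iff algebra_simps)
    next
      case False
      have "linear (\<lambda>x. \<beta> ((map (\<lambda>l'. vs ! p l') [j..<j+m])[l - j := x]))"
        by (rule Alt_linear_update[OF \<beta>]) (use False l in auto)
      then show ?thesis using False l unfolding t
        by (simp add: upd id[of 0 j] linear_iff algebra_simps)
    qed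
  qed
  show ?thesis
    unfolding Alt_def
  proof (intro CollectI conjI allI impI)
    fix vs :: "'a list" and i
    assume *: "length vs = j + m \<and> i < j + m"
    then have "linear (\<lambda>x. (\<Sum>p | p permutes {..<j+m}. t (vs[i := x]) p) / (fact j * fact m))"
      using linear_compose_scale_right[OF linear_compose_sum[of "{p. p permutes {..<j+m}}" "\<lambda>p x. t (vs[i := x]) p"],
        of "1 / (fact j * fact m)"] lin[of vs i]
      by simp
    then show "linear (\<lambda>x. wedge j m \<alpha> \<beta> (vs[i := x]))" using * by (simp add: w)
  next
    fix vs :: "'a list" and a b
    assume *: "length vs = j + m \<and> a < b \<and> b < j + m \<and> vs ! a = vs ! b"
    \<comment> \<open>Left composition with the transposition leaves all arguments unchanged and
      flips the sign, so the sum equals its own negative.\<close>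
    have tr: "Transposition.transpose a b permutes {..<j+m}" using * by (intro permutes_swap_id) auto
    have "(\<Sum>p | p permutes {..<j+m}. t vs p) = (\<Sum>p | p permutes {..<j+m}. t vs (Transposition.transpose a b \<circ> p))"
      by (rule setum_permutations_compose_left[OF tr])
    also have "\<dots> = (\<Sum>p | p permutes {..<j+m}. - t vs p)"
    proof (rule sum.cong)
      fix p assume "p \<in> {p. p permutes {..<j+m}}"
      then have p: "permutation p" using permutes_imp_permutation[of "{..<j+m}"] by auto
      have "sign (Transposition.transpose a b \<circ> p) = - sign p"
        using * p by (simp add: sign_compose permutation_swap_id sign_swap_id)
      moreover have "vs ! Transposition.transpose a b l = vs ! l" for l
        using * by (auto simp: Transposition.transpose_def)
      ultimately show "t vs (Transposition.transpose a b \<circ> p) = - t vs p" by (simp add: t_def)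
    qed simp
    finally have "(\<Sum>p | p permutes {..<j+m}. t vs p) = 0"
      by (simp add: sum_negf)
    then show "wedge j m \<alpha> \<beta> vs = 0" using * by (simp add: w)
  qed (simp add: wedge_def)
qed

text \<open>The value is \<open>1\<close>, but only positivity and independence of the forms are needed.\<close>

definition block_factor :: "nat \<Rightarrow> nat \<Rightarrow> real" where
  "block_factor j m = card {p. p permutes {..<j+m} \<and> p ` {..<j} \<subseteq> {..<j}} / (fact j * fact m)"

lemma block_factor_pos: "block_factor j m > 0"
proof -
  have "finite {p. p permutes {..<j+m} \<and> p ` {..<j} \<subseteq> {..<j}}"
    by (rule finite_subset[OF _ finite_permutations[of "{..<j+m}"]]) auto
  moreover have "id \<in> {p. p permutes {..<j+m} \<and> p ` {..<j} \<subseteq> {..<j}}" by auto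
  ultimately have "card {p. p permutes {..<j+m} \<and> p ` {..<j} \<subseteq> {..<j}} > 0"
    unfolding card_gt_0_iff by blast
  then show ?thesis by (simp add: block_factor_def)
qed

text \<open>Each surviving permutation splits into one of each block, and its sign cancels against the two
  signs coming from the forms; so all survivors contribute the same amount.\<close>

lemma wedge_block:
  assumes \<alpha>: "\<alpha> \<in> Alt (length us)" and \<beta>: "\<beta> \<in> Alt (length ws)"
    and 0: "\<And>p. p permutes {..<length us + length ws} \<Longrightarrow> \<not> p ` {..<length us} \<subseteq> {..<length us} \<Longrightarrow>
      \<alpha> (map (\<lambda>i. (us @ ws) ! p i) [0..<length us]) = 0 \<or>
      \<beta> (map (\<lambda>i. (us @ ws) ! p i) [length us..<length us + length ws]) = 0"
  shows "wedge (length us) (length ws) \<alpha> \<beta> (us @ ws)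
    = block_factor (length us) (length ws) * \<alpha> us * \<beta> ws"
proof -
  define j m where "j = length us" and "m = length ws"
  define vs where "vs = us @ ws"
  define t where "t p = of_int (sign p) * \<alpha> (map (\<lambda>i. vs ! p i) [0..<j])
      * \<beta> (map (\<lambda>i. vs ! p i) [j..<j+m])" for p
  define Q where "Q = {p. p permutes {..<j+m} \<and> p ` {..<j} \<subseteq> {..<j}}"
  have us: "map (\<lambda>i. vs ! i) [0..<j] = us"
    by (intro nth_equalityI) (auto simp: vs_def j_def nth_append)
  have ws: "map (\<lambda>i. vs ! i) [j..<j+m] = ws"
    by (intro nth_equalityI) (auto simp: vs_def j_def m_def nth_append)
  have tQ: "t p = \<alpha> us * \<beta> ws" if "p \<in> Q" for p
  proof -
    from that have p: "p permutes {..<j+m}" and sub: "p ` {..<j} \<subseteq> {..<j}" by (auto simp: Q_def)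
    have im: "p ` {..<j} = {..<j}"
      using sub by (intro card_subset_eq) (auto simp: card_image permutes_inj_on[OF p])
    define p1 where "p1 i = (if i < j then p i else i)" for i
    define p2 where "p2 i = (if i < j then i else p i)" for i
    have p1: "p1 permutes {..<j}"
    proof (rule bij_imp_permutes)
      show "bij_betw p1 {..<j} {..<j}"
        using im permutes_inj_on[OF p, of "{..<j}"] by (auto simp: bij_betw_def p1_def inj_on_def)
    qed (auto simp: p1_def)
    have im2: "p ` {j..<j+m} = {j..<j+m}"
    proof -
      have "p ` ({..<j+m} - {..<j}) = p ` {..<j+m} - p ` {..<j}"
        by (rule image_set_diff[OF permutes_inj[OF p]])
      also have "{..<j+m} - {..<j} = {j..<j+m}" by auto
      finally show ?thesis using im permutes_image[OF p] by auto
    qed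
    have p2: "p2 permutes {j..<j+m}"
    proof (rule bij_imp_permutes)
      show "bij_betw p2 {j..<j+m} {j..<j+m}"
        using im2 permutes_inj_on[OF p, of "{j..<j+m}"] by (auto simp: bij_betw_def p2_def inj_on_def)
      fix i assume "i \<notin> {j..<j+m}"
      then show "p2 i = i" using permutes_not_in[OF p, of i] by (auto simp: p2_def)
    qed
    have "p = p1 \<circ> p2"
    proof
      fix i
      have "p2 i \<ge> j" if "i \<ge> j"
        using that permutes_in_image[OF p2, of i] permutes_not_in[OF p2, of i] by force
      then show "p i = (p1 \<circ> p2) i" by (auto simp: p1_def p2_def not_less)
    qed
    then have sgn: "sign p = sign p1 * sign p2"
      using permutes_imp_permutation[OF _ p1] permutes_imp_permutation[OF _ p2]
      by (simp add: sign_compose)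
    have "map (\<lambda>i. vs ! p i) [0..<j] = map ((\<lambda>i. vs ! i) \<circ> p1) [0..<j]"
      by (intro map_cong) (auto simp: p1_def)
    then have a: "\<alpha> (map (\<lambda>i. vs ! p i) [0..<j]) = of_int (sign p1) * \<alpha> us"
      using Alt_permute[OF \<alpha>, of p1 0 j "\<lambda>i. vs ! i"] p1 us by (simp only: atLeast0LessThan)
    have "map (\<lambda>i. vs ! p i) [j..<j+m] = map ((\<lambda>i. vs ! i) \<circ> p2) [j..<j+m]"
      by (intro map_cong) (auto simp: p2_def)
    then have b: "\<beta> (map (\<lambda>i. vs ! p i) [j..<j+m]) = of_int (sign p2) * \<beta> ws"
      using Alt_permute[OF \<beta>, of p2 j "j+m" "\<lambda>i. vs ! i"] p2 ws by (simp only:)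
    have "t p = of_int (sign p1 * sign p1) * of_int (sign p2 * sign p2) * (\<alpha> us * \<beta> ws)"
      by (simp only: t_def sgn a b of_int_mult mult_ac)
    then show ?thesis by simp
  qed
  have fin: "finite {p. p permutes {..<j+m}}" by (rule finite_permutations) simp
  have "(\<Sum>p | p permutes {..<j+m}. t p) = sum t Q"
    using 0 by (intro sum.mono_neutral_right[OF fin])
      (auto simp: Q_def t_def j_def m_def vs_def)
  also have "\<dots> = card Q * (\<alpha> us * \<beta> ws)" using tQ by simp
  finally have s: "(\<Sum>p | p permutes {..<j+m}. t p) = card Q * (\<alpha> us * \<beta> ws)" .
  then show ?thesis
    by (simp add: wedge_def t_def vs_def j_def m_def block_factor_def Q_def)
qed

lemma wedge_list_in_Alt:
  assumes "\<And>f. f \<in> set fs \<Longrightarrow> linear f"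
  shows "wedge_list (map covector fs) \<in> Alt (length fs)"
  using assms
proof (induction fs)
  case Nil
  then show ?case by (auto simp: Alt_def)
next
  case (Cons f fs)
  then show ?case
    using wedge_in_Alt[OF covector_in_Alt[of f], of "wedge_list (map covector fs)" "length fs"]
    by simp
qed

text \<open>The matrix of values has a zero row.\<close>

lemma wedge_list_eq_0:
  assumes "f \<in> set fs" "\<And>v. v \<in> set vs \<Longrightarrow> f v = 0"
  shows "wedge_list (map covector fs) vs = 0"
  using assms
proof (induction fs arbitrary: vs)
  case (Cons g fs)
  let ?\<beta> = "wedge_list (map covector fs)"
  have "covector g (map (\<lambda>i. vs ! p i) [0..<1]) * ?\<beta> (map (\<lambda>i. vs ! p i) [1..<1 + length fs]) = 0"
    if p: "p permutes {..<1 + length fs}" and len: "length vs = 1 + length fs" for p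
  proof -
    have in_vs: "vs ! p i \<in> set vs" if "i < 1 + length fs" for i
      using permutes_in_image[OF p, of i] that len by simp
    show ?thesis
    proof (cases "f = g")
      case True
      then show ?thesis using Cons.prems(2) in_vs[of 0] by (simp add: covector_def)
    next
      case False
      then have "?\<beta> (map (\<lambda>i. vs ! p i) [1..<1 + length fs]) = 0"
        using Cons.prems in_vs by (intro Cons.IH) auto
      then show ?thesis by simp
    qed
  qed
  then have "(\<Sum>p | p permutes {..<1 + length fs}. of_int (sign p)
      * covector g (map (\<lambda>i. vs ! p i) [0..<1]) * ?\<beta> (map (\<lambda>i. vs ! p i) [1..<1 + length fs])) = 0"
    if "length vs = 1 + length fs" using that
    by (intro sum.neutral) (auto simp: mult.assoc)
  then show ?case unfolding wedge_list.simps list.map wedge_def by simp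
qed simp

text \<open>The matrix of values has a zero column. In each permutation the vector \<open>v\<close>
  is fed either to the first covector or to the remaining wedge.\<close>

lemma wedge_list_eq_0':
  assumes "v \<in> set vs" "\<And>f. f \<in> set fs \<Longrightarrow> f v = 0"
  shows "wedge_list (map covector fs) vs = 0"
  using assms
proof (induction fs arbitrary: vs)
  case (Cons g fs)
  let ?\<beta> = "wedge_list (map covector fs)"
  have "covector g (map (\<lambda>i. vs ! p i) [0..<1]) * ?\<beta> (map (\<lambda>i. vs ! p i) [1..<1 + length fs]) = 0"
    if p: "p permutes {..<1 + length fs}" and len: "length vs = 1 + length fs" for p
  proof -
    obtain i where i: "i < length vs" "vs ! i = v" using Cons.prems(1) by (auto simp: in_set_conv_nth)
    then obtain l where l: "l < 1 + length fs" "p l = i"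
      using p len by (metis lessThan_iff permutes_inverses(1) permutes_inv permutes_in_image)
    show ?thesis
    proof (cases "l = 0")
      case True
      then show ?thesis using Cons.prems(2)[of g] i l by (simp add: covector_def)
    next
      case False
      then have "l \<in> set [1..<1 + length fs]"
        unfolding set_upt atLeastLessThan_iff using l(1) by linarith
      then have "v \<in> set (map (\<lambda>i. vs ! p i) [1..<1 + length fs])"
        unfolding set_map using l i by blast
      then have "?\<beta> (map (\<lambda>i. vs ! p i) [1..<1 + length fs]) = 0"
        using Cons.prems(2) by (intro Cons.IH) auto
      then show ?thesis by simp
    qed
  qed
  then have "(\<Sum>p | p permutes {..<1 + length fs}. of_int (sign p)
      * covector g (map (\<lambda>i. vs ! p i) [0..<1]) * ?\<beta> (map (\<lambda>i. vs ! p i) [1..<1 + length fs])) = 0"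
    if "length vs = 1 + length fs" using that
    by (intro sum.neutral) (auto simp: mult.assoc)
  then show ?case unfolding wedge_list.simps list.map wedge_def by simp
qed auto

text \<open>The matrix of values is the identity. Splitting off the first covector with
  \<open>wedge_block\<close>, a permutation that moves position 0 contributes an off-diagonal
  zero.\<close>

lemma wedge_list_dual_neq_0:
  assumes "\<And>f. f \<in> set fs \<Longrightarrow> linear f" "length vs = length fs"
    and "\<And>i l. i < length fs \<Longrightarrow> l < length fs \<Longrightarrow> (fs ! i) (vs ! l) = (if i = l then 1 else 0)"
  shows "wedge_list (map covector fs) vs \<noteq> 0"
  using assms
proof (induction fs arbitrary: vs)
  case (Cons g fs)
  then obtain v ws where vs: "vs = v # ws" "length ws = length fs" by (cases vs) auto
  let ?\<beta> = "wedge_list (map covector fs)"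
  have nz: "?\<beta> ws \<noteq> 0"
  proof (rule Cons.IH)
    fix i l assume "i < length fs" "l < length fs"
    then show "(fs ! i) (ws ! l) = (if i = l then 1 else 0)"
      using Cons.prems(3)[of "Suc i" "Suc l"] vs by simp
  qed (use Cons.prems vs in auto)
  have g: "g v = 1" using Cons.prems(3)[of 0 0] vs by simp
  have "wedge (length [v]) (length ws) (covector g) ?\<beta> ([v] @ ws)
      = block_factor (length [v]) (length ws) * covector g [v] * ?\<beta> ws"
  proof (rule wedge_block)
    show "covector g \<in> Alt (length [v])" using covector_in_Alt[of g] Cons.prems by simp
    show "?\<beta> \<in> Alt (length ws)" using wedge_list_in_Alt[of fs] Cons.prems vs by simp
    fix p assume p: "p permutes {..<length [v] + length ws}"
      "\<not> p ` {..<length [v]} \<subseteq> {..<length [v]}"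
    then have "p 0 \<noteq> 0" "p 0 < 1 + length fs" using vs permutes_in_image[OF p(1), of 0] by auto
    then have "g (vs ! p 0) = 0" using Cons.prems(3)[of 0 "p 0"] by simp
    then show "covector g (map (\<lambda>i. ([v] @ ws) ! p i) [0..<length [v]]) = 0 \<or>
         ?\<beta> (map (\<lambda>i. ([v] @ ws) ! p i) [length [v]..<length [v] + length ws]) = 0"
      using vs by (simp add: covector_def)
  qed
  moreover have "covector g [v] = 1" using g by (simp add: covector_def)
  ultimately show ?case using nz vs block_factor_pos[of 1 "length ws"] by simp
qed simp

section \<open>The Hodge star\<close>

abbreviation units :: "'n::finite list \<Rightarrow> (real^'n) list"
  where "units is \<equiv> map unit_vec is"

abbreviation coords :: "'n::{finite,linorder} list"
  where "coords \<equiv> sorted_list_of_set UNIV"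

lemma span_unit_vecs: "span (range (unit_vec :: 'n::finite \<Rightarrow> real^'n)) = UNIV"
proof -
  have "Basis = range (unit_vec :: 'n \<Rightarrow> real^'n)" by (auto simp: Basis_vec_def)
  then show ?thesis using span_Basis by metis
qed

lemma finite_increasing_seqs: "finite (increasing_seqs j :: 'n::{finite,linorder} list set)"
  by (rule finite_subset[OF _ finite_lists_length_eq[of UNIV j]])
    (auto simp: increasing_seqs_def)

lemma sum_increasing_seqs:
  "(\<Sum>is\<in>increasing_seqs j. g is)
    = (\<Sum>I | card (I :: 'n::{finite,linorder} set) = j. g (sorted_list_of_set I))"
proof (rule sum.reindex_bij_witness[where i = sorted_list_of_set and j = set])
  fix xs :: "'n list" assume "xs \<in> increasing_seqs j"
  then have xs: "length xs = j" "sorted_wrt (<) xs" by (auto simp: increasing_seqs_def)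
  then show "sorted_list_of_set (set xs) = xs" "set xs \<in> {I. card I = j}"
    by (auto simp: strict_sorted_iff distinct_card sorted_list_of_set.idem_if_sorted_distinct)
  then show "g (sorted_list_of_set (set xs)) = g xs" by simp
qed (auto simp: increasing_seqs_def)

lemma Alt_eq_0_increasing:
  fixes f :: "(real^'n::{finite,linorder}) form"
  assumes f: "f \<in> Alt j" and 0: "\<And>is. is \<in> increasing_seqs j \<Longrightarrow> f (units is) = 0"
  shows "f = 0"
proof (rule Alt_eq_0_on_span[OF f span_unit_vecs])
  fix vs :: "(real^'n::_) list"
  assume vs: "set vs \<subseteq> range unit_vec" "distinct vs" "length vs = j"
  then obtain js where js: "vs = units js" by (metis ex_map_conv subset_iff rangeE)
  then have "distinct js" using vs by (simp add: distinct_map)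
  then have "mset (sort js) = mset js" "sort js \<in> increasing_seqs j"
    using vs js by (auto simp: increasing_seqs_def strict_sorted_iff)
  then show "f vs = 0" using 0[of "sort js"] Alt_mset_cong[OF f, of "units (sort js)" vs] js
    by (metis mset_map)
qed

text \<open>The two signs cancel. Products of this kind occur in the inner product, which can
  therefore be computed with any ordering of each coordinate set.\<close>

lemma Alt_prod_mset_cong:
  assumes f: "f \<in> Alt j" and g: "g \<in> Alt l" and eq: "mset vs = mset ws"
  shows "f vs * g vs = f ws * g ws"
proof -
  obtain \<pi> where \<pi>: "\<pi> permutes {..<length ws}" "permute_list \<pi> ws = vs"
    using mset_eq_permutation[of vs ws] eq by metis
  have "f vs * g vs = of_int (sign \<pi> * sign \<pi>) * (f ws * g ws)"
    using Alt_permute_list[OF f \<pi>(1)] Alt_permute_list[OF g \<pi>(1)] \<pi>(2)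
    by (simp only: of_int_mult mult_ac)
  then show ?thesis by simp
qed

section \<open>Top-degree forms and sums over orderings of the coordinates\<close>

lemma perm_UNIV_iff:
  "xs \<in> permutations_of_set (UNIV :: 'n::finite set) \<longleftrightarrow> distinct xs \<and> length xs = CARD('n)"
proof
  assume "distinct xs \<and> length xs = CARD('n)"
  then have "set xs = UNIV" by (intro card_subset_eq) (auto simp: distinct_card)
  then show "xs \<in> permutations_of_set UNIV"
    using \<open>distinct xs \<and> length xs = CARD('n)\<close> by auto
qed (auto simp: permutations_of_set_def distinct_card[symmetric])

lemma coords_perm: "(coords :: 'n::{finite,linorder} list) \<in> permutations_of_set UNIV"
  by (auto simp: permutations_of_set_def)

text \<open>Top-degree forms span a line. The combination \<open>h\<close> vanishes on
  \<open>coords\<close>, the only increasing sequence of full length; cross-multiplication avoids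
  any division. The lemma later moves evaluations from coordinate vectors to edges of the
  simplex.\<close>

lemma Alt_top_proportional:
  fixes f g :: "(real^'n::{finite,linorder}) form"
  assumes f: "f \<in> Alt CARD('n)" and g: "g \<in> Alt CARD('n)"
  shows "f vs * g (units coords) = f (units coords) * g vs"
proof -
  define h where "h = g (units coords) *\<^sub>R f - f (units coords) *\<^sub>R g"
  have h: "h \<in> Alt CARD('n)"
    unfolding h_def by (intro subspace_diff subspace_scale subspace_Alt f g)
  have "h = 0"
  proof (rule Alt_eq_0_increasing[OF h])
    fix xs :: "'n list" assume "xs \<in> increasing_seqs CARD('n)"
    then have "length xs = CARD('n)" "sorted_wrt (<) xs" by (auto simp: increasing_seqs_def)
    then have "xs = coords"
      using perm_UNIV_iff[of xs] sorted_list_of_set.idem_if_sorted_distinct[of xs]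
      by (auto simp: strict_sorted_iff permutations_of_set_def)
    then show "h (units xs) = 0" by (simp add: h_def scaleR_fun_def)
  qed
  then have "h vs = 0" by simp
  then show ?thesis by (simp add: h_def scaleR_fun_def mult_ac)
qed

lemma volume_form_in_Alt: "(volume_form :: (real^'n::{finite,linorder}) form) \<in> Alt CARD('n)"
proof -
  have "wedge_list (map covector (map (\<lambda>i (v :: real^'n::_). v $ i) (coords :: 'n list)))
      \<in> Alt (length (map (\<lambda>i (v :: real^'n::_). v $ i) (coords :: 'n list)))"
    by (rule wedge_list_in_Alt) (auto simp: linear_iff)
  then show ?thesis by (simp add: volume_form_def comp_def)
qed

lemma volume_form_coords: "volume_form (units (coords :: 'n::{finite,linorder} list)) \<noteq> 0"
proof -
  have "wedge_list (map covector (map (\<lambda>i v. v $ i) (coords :: 'n list))) (units coords) \<noteq> 0"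
    by (rule wedge_list_dual_neq_0)
      (auto simp: linear_iff axis_def nth_eq_iff_index_eq)
  then show ?thesis by (simp add: volume_form_def comp_def)
qed

lemma volume_form_perm:
  assumes "\<pi> permutes {..<CARD('n)}"
  shows "volume_form (units (permute_list \<pi> (coords :: 'n::{finite,linorder} list)))
    = of_int (sign \<pi>) * volume_form (units (coords :: 'n list))"
proof -
  have "units (permute_list \<pi> coords) = permute_list \<pi> (units (coords :: 'n list))"
    using assms by (simp add: permute_list_map)
  then show ?thesis using Alt_permute_list[OF volume_form_in_Alt, of \<pi> "units (coords :: 'n list)"]
    assms by simp
qed

lemma volume_form_neq_0:
  assumes "xs \<in> permutations_of_set (UNIV :: 'n::{finite,linorder} set)"
  shows "volume_form (units xs) \<noteq> 0"
proof
  assume "volume_form (units xs) = 0"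
  moreover have "mset (units xs) = mset (units coords)"
    using assms coords_perm set_eq_iff_mset_eq_distinct[of xs coords]
    by (auto simp: permutations_of_set_def)
  ultimately have "volume_form (units (coords :: 'n list)) = 0"
    using Alt_mset_cong[OF volume_form_in_Alt] by blast
  then show False using volume_form_coords by blast
qed

lemma bij_betw_permute_coords:
  "bij_betw (\<lambda>\<pi>. permute_list \<pi> (coords :: 'n::{finite,linorder} list))
    {\<pi>. \<pi> permutes {..<CARD('n)}} (permutations_of_set UNIV)"
proof (rule bij_betw_imageI)
  show "inj_on (\<lambda>\<pi>. permute_list \<pi> (coords :: 'n list)) {\<pi>. \<pi> permutes {..<CARD('n)}}"
  proof (rule inj_onI)
    fix p q assume p: "p \<in> {\<pi>. \<pi> permutes {..<CARD('n)}}" and q: "q \<in> {\<pi>. \<pi> permutes {..<CARD('n)}}"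
      and eq: "permute_list p (coords :: 'n list) = permute_list q coords"
    show "p = q"
    proof
      fix i
      show "p i = q i"
      proof (cases "i < CARD('n)")
        case True
        then have "(coords :: 'n list) ! p i = coords ! q i"
          using arg_cong[OF eq, of "\<lambda>l. l ! i"] p q by (simp add: permute_list_nth)
        moreover have "p i < CARD('n)" "q i < CARD('n)"
          using True permutes_in_image[of p "{..<CARD('n)}" i] permutes_in_image[of q "{..<CARD('n)}" i] p q
          by auto
        ultimately show ?thesis by (simp add: nth_eq_iff_index_eq)
      next
        case False
        then show ?thesis using p q by (auto simp: permutes_not_in)
      qed
    qed
  qed
  show "(\<lambda>\<pi>. permute_list \<pi> (coords :: 'n list)) ` {\<pi>. \<pi> permutes {..<CARD('n)}} = permutations_of_set UNIV"
  proof (intro equalityI subsetI)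
    fix xs :: "'n list" assume xs: "xs \<in> permutations_of_set UNIV"
    then have "mset xs = mset (coords :: 'n list)"
      using set_eq_iff_mset_eq_distinct[of xs coords] by (auto simp: permutations_of_set_def)
    then obtain \<pi> where "\<pi> permutes {..<length (coords :: 'n list)}" "permute_list \<pi> coords = xs"
      using mset_eq_permutation by metis
    then show "xs \<in> (\<lambda>\<pi>. permute_list \<pi> (coords :: 'n list)) ` {\<pi>. \<pi> permutes {..<CARD('n)}}"
      by auto
  qed (auto simp: permutations_of_set_def)
qed

lemma sum_fun_apply: "(\<Sum>i\<in>A. f i) x = (\<Sum>i\<in>A. f i x)"
  by (induction A rule: infinite_finite_induct) auto

text \<open>The factor \<open>volume_form (units coords)\<close> turns the sign of each permutation
  into the value of the volume form on the permuted basis. Wedge, inner product and star thus all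
  become sums over orderings of the coordinates.\<close>

lemma wedge_coords:
  fixes \<alpha> \<beta> :: "(real^'n::{finite,linorder}) form"
  assumes jm: "j + m = CARD('n)"
  shows "wedge j m \<alpha> \<beta> (units coords) * volume_form (units (coords :: 'n list))
    = (\<Sum>xs\<in>permutations_of_set UNIV. volume_form (units xs) * \<alpha> (units (take j xs))
        * \<beta> (units (drop j xs))) / (fact j * fact m)"
proof -
  let ?c = "coords :: 'n list"
  have t: "map (\<lambda>i. units ?c ! \<pi> i) [0..<j] = units (take j (permute_list \<pi> ?c))"
    and d: "map (\<lambda>i. units ?c ! \<pi> i) [j..<j + m] = units (drop j (permute_list \<pi> ?c))"
    if \<pi>: "\<pi> permutes {..<CARD('n)}" for \<pi>
  proof -
    have "units ?c ! \<pi> i = unit_vec (permute_list \<pi> ?c ! i)" if "i < CARD('n)" for i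
      using permutes_in_image[OF \<pi>, of i] that \<pi> by (simp add: permute_list_nth)
    then show "map (\<lambda>i. units ?c ! \<pi> i) [0..<j] = units (take j (permute_list \<pi> ?c))"
      "map (\<lambda>i. units ?c ! \<pi> i) [j..<j + m] = units (drop j (permute_list \<pi> ?c))"
      using jm by (auto intro!: nth_equalityI)
  qed
  have "(\<Sum>xs\<in>permutations_of_set UNIV. volume_form (units xs) * \<alpha> (units (take j xs))
        * \<beta> (units (drop j xs)))
    = (\<Sum>\<pi> | \<pi> permutes {..<CARD('n)}. volume_form (units (permute_list \<pi> ?c))
        * \<alpha> (units (take j (permute_list \<pi> ?c))) * \<beta> (units (drop j (permute_list \<pi> ?c))))"
    by (rule sum.reindex_bij_betw[OF bij_betw_permute_coords, symmetric])
  also have "\<dots> = (\<Sum>\<pi> | \<pi> permutes {..<CARD('n)}. (of_int (sign \<pi>)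
        * \<alpha> (map (\<lambda>i. units ?c ! \<pi> i) [0..<j]) * \<beta> (map (\<lambda>i. units ?c ! \<pi> i) [j..<j + m]))
        * volume_form (units ?c))"
    by (intro sum.cong) (auto simp: t d volume_form_perm)
  also have "\<dots> = (\<Sum>\<pi> | \<pi> permutes {..<CARD('n)}. of_int (sign \<pi>)
        * \<alpha> (map (\<lambda>i. units ?c ! \<pi> i) [0..<j]) * \<beta> (map (\<lambda>i. units ?c ! \<pi> i) [j..<j + m]))
        * volume_form (units ?c)"
    by (rule sum_distrib_right[symmetric])
  finally show ?thesis using jm by (simp add: wedge_def)
qed

text \<open>A set of size \<open>j\<close> is the set of the first \<open>j\<close> entries of
  exactly \<open>fact j * fact m\<close> orderings: each is an ordering of the set followed by one
  of its complement.\<close>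

lemma sum_perms_take:
  fixes h :: "'n::finite set \<Rightarrow> real"
  assumes jm: "j + m = CARD('n)"
  shows "(\<Sum>xs\<in>permutations_of_set UNIV. h (set (take j xs)))
    = fact j * fact m * (\<Sum>I | card I = j. h I)"
proof -
  let ?P = "permutations_of_set (UNIV :: 'n set)"
  have c: "card {xs \<in> ?P. set (take j xs) = I} = fact j * fact m" if I: "card I = j" for I
  proof -
    have "{xs \<in> ?P. set (take j xs) = I}
        = (\<lambda>(us, ws). us @ ws) ` (permutations_of_set I \<times> permutations_of_set (- I))" (is "?L = ?R")
    proof (intro equalityI subsetI)
      fix xs assume "xs \<in> ?L"
      then have xs: "distinct xs" "set xs = UNIV" "set (take j xs) = I"
        by (auto simp: permutations_of_set_def)
      have "set (take j xs) \<union> set (drop j xs) = UNIV" "set (take j xs) \<inter> set (drop j xs) = {}"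
        using xs(1,2) by (metis append_take_drop_id set_append) (use xs(1) in \<open>simp add: set_take_disj_set_drop_if_distinct\<close>)
      then have "set (drop j xs) = - I" using xs(3) by auto
      then have "take j xs \<in> permutations_of_set I" "drop j xs \<in> permutations_of_set (- I)"
        using xs by auto
      then show "xs \<in> ?R" by (intro image_eqI[of _ _ "(take j xs, drop j xs)"]) auto
    next
      fix xs assume "xs \<in> ?R"
      then obtain us ws where *: "xs = us @ ws" "us \<in> permutations_of_set I"
        "ws \<in> permutations_of_set (- I)" by auto
      then have "length us = j" using I by (simp add: length_finite_permutations_of_set)
      then show "xs \<in> ?L" using * by (auto simp: permutations_of_set_def)
    qed
    moreover have "inj_on (\<lambda>(us, ws). us @ ws) (permutations_of_set I \<times> permutations_of_set (- I))"
      by (auto simp: inj_on_def append_eq_append_conv dest!: length_finite_permutations_of_set)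
    moreover have "card (- I) = m" using I jm by (simp add: Compl_eq_Diff_UNIV card_Diff_subset)
    ultimately show ?thesis using I by (simp add: card_image card_cartesian_product)
  qed
  have "(\<Sum>xs\<in>?P. h (set (take j xs)))
      = (\<Sum>I | card I = j. \<Sum>xs | xs \<in> ?P \<and> set (take j xs) = I. h (set (take j xs)))"
    using jm by (intro sum.group[symmetric])
      (auto simp: perm_UNIV_iff distinct_card)
  also have "\<dots> = (\<Sum>I | card I = j. fact j * fact m * h I)"
    by (intro sum.cong) (auto simp: c)
  finally show ?thesis by (simp add: sum_distrib_left)
qed

lemma sum_perms_drop:
  fixes h :: "'n::finite set \<Rightarrow> real"
  assumes jm: "j + m = CARD('n)"
  shows "(\<Sum>xs\<in>permutations_of_set UNIV. h (set (drop j xs)))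
    = fact j * fact m * (\<Sum>I | card I = m. h I)"
proof -
  have "(\<Sum>xs\<in>permutations_of_set UNIV. h (set (drop j xs)))
      = (\<Sum>xs\<in>permutations_of_set UNIV. h (- set (take j xs)))"
  proof (rule sum.cong)
    fix xs :: "'n list" assume "xs \<in> permutations_of_set UNIV"
    then have xs: "distinct xs" "set xs = UNIV" by (auto simp: permutations_of_set_def)
    have "set (take j xs) \<union> set (drop j xs) = UNIV" "set (take j xs) \<inter> set (drop j xs) = {}"
      using xs by (metis append_take_drop_id set_append) (use xs(1) in \<open>simp add: set_take_disj_set_drop_if_distinct\<close>)
    then have "set (drop j xs) = - set (take j xs)" by auto
    then show "h (set (drop j xs)) = h (- set (take j xs))" by simp
  qed simp
  also have "\<dots> = fact j * fact m * (\<Sum>I | card (I :: 'n set) = j. h (- I))"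
    by (rule sum_perms_take[OF jm, where h = "\<lambda>I. h (- I)"])
  also have "(\<Sum>I | card (I :: 'n set) = j. h (- I)) = (\<Sum>I | card I = m. h I)"
    using jm by (intro sum.reindex_bij_witness[where i = uminus and j = uminus])
      (auto simp: Compl_eq_Diff_UNIV card_Diff_subset)
  finally show ?thesis .
qed

text \<open>By \<open>Alt_prod_mset_cong\<close> the summand sees only the set of the first
  \<open>j\<close> entries, so \<open>sum_perms_take\<close> counts each increasing sequence equally
  often.\<close>

lemma form_inner_perms_take:
  fixes \<omega> \<eta> :: "(real^'n::{finite,linorder}) form"
  assumes jm: "j + m = CARD('n)" and "\<omega> \<in> Alt j" "\<eta> \<in> Alt j"
  shows "form_inner j \<omega> \<eta> = (\<Sum>xs\<in>permutations_of_set UNIV.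
    \<omega> (units (take j xs)) * \<eta> (units (take j xs))) / (fact j * fact m)"
proof -
  let ?h = "\<lambda>I. \<omega> (units (sorted_list_of_set I)) * \<eta> (units (sorted_list_of_set I))"
  have "(\<Sum>xs\<in>permutations_of_set UNIV. \<omega> (units (take j xs)) * \<eta> (units (take j xs)))
      = (\<Sum>xs\<in>permutations_of_set UNIV. ?h (set (take j xs)))"
  proof (rule sum.cong)
    fix xs :: "'n list" assume "xs \<in> permutations_of_set UNIV"
    then have "mset (take j xs) = mset (sorted_list_of_set (set (take j xs)))"
      by (simp add: permutations_of_set_def set_eq_iff_mset_eq_distinct[symmetric])
    then show "\<omega> (units (take j xs)) * \<eta> (units (take j xs)) = ?h (set (take j xs))"
      by (intro Alt_prod_mset_cong[OF assms(2,3)]) simp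
  qed simp
  then show ?thesis using sum_perms_take[OF jm, of ?h]
    by (simp add: form_inner_def sum_increasing_seqs)
qed

lemma form_inner_perms_drop:
  fixes \<omega> \<eta> :: "(real^'n::{finite,linorder}) form"
  assumes jm: "j + m = CARD('n)" and "\<omega> \<in> Alt m" "\<eta> \<in> Alt m"
  shows "form_inner m \<omega> \<eta> = (\<Sum>xs\<in>permutations_of_set UNIV.
    \<omega> (units (drop j xs)) * \<eta> (units (drop j xs))) / (fact j * fact m)"
proof -
  let ?h = "\<lambda>I. \<omega> (units (sorted_list_of_set I)) * \<eta> (units (sorted_list_of_set I))"
  have "(\<Sum>xs\<in>permutations_of_set UNIV. \<omega> (units (drop j xs)) * \<eta> (units (drop j xs)))
      = (\<Sum>xs\<in>permutations_of_set UNIV. ?h (set (drop j xs)))"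
  proof (rule sum.cong)
    fix xs :: "'n list" assume "xs \<in> permutations_of_set UNIV"
    then have "mset (drop j xs) = mset (sorted_list_of_set (set (drop j xs)))"
      by (simp add: permutations_of_set_def set_eq_iff_mset_eq_distinct[symmetric])
    then show "\<omega> (units (drop j xs)) * \<eta> (units (drop j xs)) = ?h (set (drop j xs))"
      by (intro Alt_prod_mset_cong[OF assms(2,3)]) simp
  qed simp
  then show ?thesis using sum_perms_drop[OF jm, of ?h]
    by (simp add: form_inner_def sum_increasing_seqs)
qed

section \<open>The Hodge star as a contraction of the volume form\<close>

text \<open>This sends \<open>dx\<^sub>I\<close> to the contraction of the volume form with \<open>e\<^sub>I\<close>.\<close>

definition hodge_sum :: "nat \<Rightarrow> (real^'n::{finite,linorder}) form \<Rightarrow> (real^'n::_) form" where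
  "hodge_sum j \<eta> vs = (\<Sum>is\<in>increasing_seqs j. \<eta> (units is) * volume_form (units is @ vs))"

lemma hodge_sum_in_Alt:
  fixes \<eta> :: "(real^'n::{finite,linorder}) form"
  assumes jm: "j + m = CARD('n)"
  shows "hodge_sum j \<eta> \<in> Alt m"
proof -
  have "hodge_sum j \<eta> = (\<Sum>is\<in>increasing_seqs j. \<eta> (units is) *\<^sub>R (\<lambda>vs. volume_form (units is @ vs @ [])))"
    by (auto simp: hodge_sum_def fun_eq_iff scaleR_fun_def sum_fun_apply)
  also have "\<dots> \<in> Alt m"
    using jm by (intro subspace_sum subspace_scale subspace_Alt Alt_append_middle)
      (auto simp: increasing_seqs_def volume_form_in_Alt)
  finally show ?thesis .
qed

text \<open>Any index set other than that of the first \<open>j\<close> entries meets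
  \<open>drop j xs\<close>, and then the volume form has a repeated argument. One term
  survives.\<close>

lemma hodge_sum_units:
  fixes \<eta> :: "(real^'n::{finite,linorder}) form"
  assumes \<eta>: "\<eta> \<in> Alt j" and xs: "xs \<in> permutations_of_set UNIV" and jm: "j + m = CARD('n)"
  shows "hodge_sum j \<eta> (units (drop j xs)) = \<eta> (units (take j xs)) * volume_form (units xs)"
proof -
  let ?us = "take j xs" and ?ws = "drop j xs"
  let ?t = "\<lambda>I. \<eta> (units (sorted_list_of_set I)) * volume_form (units (sorted_list_of_set I) @ units ?ws)"
  have d: "distinct xs" "length xs = CARD('n)" using xs by (auto simp: perm_UNIV_iff)
  have du: "set ?us \<union> set ?ws = UNIV"
    using xs by (metis append_take_drop_id set_append permutations_of_setD(1))
  have card_us: "card (set ?us) = j" using d jm by (simp add: distinct_card)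
  have "?t I = 0" if I: "I \<in> {I. card I = j} - {set ?us}" for I
  proof -
    have "\<not> distinct (sorted_list_of_set I @ ?ws)"
    proof
      assume "distinct (sorted_list_of_set I @ ?ws)"
      then have "I \<subseteq> set ?us" using du by auto
      then have "I = set ?us" using I card_us by (intro card_subset_eq) auto
      then show False using I by simp
    qed
    then have "\<not> distinct (units (sorted_list_of_set I) @ units ?ws)"
      by (metis distinct_map map_append)
    then have "volume_form (units (sorted_list_of_set I) @ units ?ws) = 0"
      by (rule Alt_not_distinct[OF volume_form_in_Alt])
    then show ?thesis by simp
  qed
  then have "hodge_sum j \<eta> (units ?ws) = sum ?t {set ?us}"
    unfolding hodge_sum_def sum_increasing_seqs using card_us
    by (intro sum.mono_neutral_right) auto
  also have "\<dots> = \<eta> (units ?us) * volume_form (units ?us @ units ?ws @ [])"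
  proof -
    \<comment> \<open>The volume form is alternating in its first block alone, so passing from the
      sorted list to \<open>take j xs\<close> changes both factors by the same sign.\<close>
    have g: "(\<lambda>vs. volume_form (vs @ units ?ws)) \<in> Alt j"
      using Alt_append_middle[of volume_form "[]" j "units ?ws"] volume_form_in_Alt[where 'n='n] d jm
      by simp
    have "mset (sorted_list_of_set (set ?us)) = mset ?us"
      using d by (simp add: set_eq_iff_mset_eq_distinct[symmetric])
    then show ?thesis using Alt_prod_mset_cong[OF \<eta> g, of "units (sorted_list_of_set (set ?us))" "units ?us"]
      by simp
  qed
  also have "units ?us @ units ?ws @ [] = units xs" by (metis append_Nil2 append_take_drop_id map_append)
  finally show ?thesis .
qed

lemma volume_form_square:
  assumes "xs \<in> permutations_of_set (UNIV :: 'n::{finite,linorder} set)"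
  shows "volume_form (units xs) * volume_form (units xs)
    = volume_form (units (coords :: 'n list)) * volume_form (units (coords :: 'n list))"
  using assms coords_perm set_eq_iff_mset_eq_distinct[of xs coords]
  by (intro Alt_prod_mset_cong[OF volume_form_in_Alt volume_form_in_Alt])
    (auto simp: permutations_of_set_def)

text \<open>Both sides have top degree, so their values on \<open>coords\<close> decide. There both
  are the same sum over orderings, once the square of the volume form, a constant, is pulled
  out.\<close>

lemma wedge_hodge_sum:
  fixes \<omega> \<eta> :: "(real^'n::{finite,linorder}) form"
  assumes \<omega>: "\<omega> \<in> Alt j" and \<eta>: "\<eta> \<in> Alt j" and jm: "j + m = CARD('n)"
  shows "wedge j m \<omega> (hodge_sum j \<eta>) = form_inner j \<omega> \<eta> *\<^sub>R volume_form"
proof -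
  let ?v = "volume_form (units (coords :: 'n list))"
  have "wedge j m \<omega> (hodge_sum j \<eta>) (units coords) * ?v
      = (\<Sum>xs\<in>permutations_of_set UNIV. (\<omega> (units (take j xs)) * \<eta> (units (take j xs))) * (?v * ?v))
        / (fact j * fact m)"
    unfolding wedge_coords[OF jm]
    by (intro arg_cong[where f = "\<lambda>x. x / (fact j * fact m)"] sum.cong)
      (auto simp: hodge_sum_units[OF \<eta> _ jm] volume_form_square[symmetric])
  also have "\<dots> = form_inner j \<omega> \<eta> * (?v * ?v)"
    unfolding form_inner_perms_take[OF jm \<omega> \<eta>] by (simp add: sum_distrib_right)
  finally have *: "wedge j m \<omega> (hodge_sum j \<eta>) (units coords) = form_inner j \<omega> \<eta> * ?v"
    using volume_form_coords[where 'n='n] by simp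
  have "wedge j m \<omega> (hodge_sum j \<eta>) \<in> Alt CARD('n)"
    using wedge_in_Alt[OF \<omega> hodge_sum_in_Alt[OF jm]] jm by simp
  from Alt_top_proportional[OF this volume_form_in_Alt] show ?thesis
    using volume_form_coords[where 'n='n] * by (simp add: fun_eq_iff scaleR_fun_def)
qed

text \<open>Both sides are the same sum over orderings. This is how the star disappears from the
  later computations: pairing with a starred form becomes a wedge product.\<close>

lemma form_inner_hodge_sum:
  fixes \<alpha> \<eta> :: "(real^'n::{finite,linorder}) form"
  assumes \<alpha>: "\<alpha> \<in> Alt m" and \<eta>: "\<eta> \<in> Alt j" and jm: "j + m = CARD('n)"
  shows "form_inner m \<alpha> (hodge_sum j \<eta>)
    = wedge j m \<eta> \<alpha> (units coords) * volume_form (units (coords :: 'n list))"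
  unfolding wedge_coords[OF jm] form_inner_perms_drop[OF jm \<alpha> hodge_sum_in_Alt[OF jm]]
  by (intro arg_cong[where f = "\<lambda>x. x / (fact j * fact m)"] sum.cong)
    (auto simp: hodge_sum_units[OF \<eta> _ jm])

text \<open>This gives uniqueness in the definite description of \<open>hodge_star\<close>. The test
  form \<omega>, the volume form contracted with the vectors at \<open>ks\<close>, is up to sign the
  basis form of the complementary coordinates; a permutation mixing the blocks feeds it a vector
  twice.\<close>

lemma wedge_nondegenerate:
  fixes \<theta> :: "(real^'n::{finite,linorder}) form"
  assumes \<theta>: "\<theta> \<in> Alt m" and jm: "j + m = CARD('n)"
    and 0: "\<And>\<omega>. \<omega> \<in> Alt j \<Longrightarrow> wedge j m \<omega> \<theta> = 0"
  shows "\<theta> = 0"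
proof (rule Alt_eq_0_increasing[OF \<theta>])
  fix ks :: "'n list" assume "ks \<in> increasing_seqs m"
  then have ks: "length ks = m" "distinct ks" by (auto simp: increasing_seqs_def strict_sorted_iff)
  define js where "js = sorted_list_of_set (- set ks)"
  have js: "length js = j" using ks jm by (simp add: js_def Compl_eq_Diff_UNIV card_Diff_subset distinct_card)
  have perm: "js @ ks \<in> permutations_of_set UNIV"
    using ks js jm by (auto simp: perm_UNIV_iff js_def)
  define \<omega> where "\<omega> vs = volume_form ([] @ vs @ units ks)" for vs
  have \<omega>: "\<omega> \<in> Alt j"
    unfolding \<omega>_def by (rule Alt_append_middle) (use ks jm volume_form_in_Alt[where 'n='n] in simp)
  have "wedge (length (units js)) (length (units ks)) \<omega> \<theta> (units js @ units ks)
      = block_factor (length (units js)) (length (units ks)) * \<omega> (units js) * \<theta> (units ks)"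
  proof (rule wedge_block)
    show "\<omega> \<in> Alt (length (units js))" "\<theta> \<in> Alt (length (units ks))"
      using \<omega> \<theta> js ks by auto
    fix p assume p: "p permutes {..<length (units js) + length (units ks)}"
      "\<not> p ` {..<length (units js)} \<subseteq> {..<length (units js)}"
    then obtain i where i: "i < j" "p i \<ge> j"
      using js by (auto simp: image_subset_iff not_less)
    then have "p i < j + m" using permutes_in_image[OF p(1), of i] js ks by simp
    then have "(units js @ units ks) ! p i \<in> set (units ks)"
      using i js ks by (auto simp: nth_append)
    moreover have "(units js @ units ks) ! p i
        \<in> set (map (\<lambda>i. (units js @ units ks) ! p i) [0..<length (units js)])"
      using i js by simp
    ultimately have "\<not> distinct ([] @ map (\<lambda>i. (units js @ units ks) ! p i) [0..<length (units js)] @ units ks)"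
      unfolding distinct_append by blast
    then have "\<omega> (map (\<lambda>i. (units js @ units ks) ! p i) [0..<length (units js)]) = 0"
      unfolding \<omega>_def by (rule Alt_not_distinct[OF volume_form_in_Alt])
    then show "\<omega> (map (\<lambda>i. (units js @ units ks) ! p i) [0..<length (units js)]) = 0 \<or>
      \<theta> (map (\<lambda>i. (units js @ units ks) ! p i)
        [length (units js)..<length (units js) + length (units ks)]) = 0" by blast
  qed
  moreover have "\<omega> (units js) \<noteq> 0"
    using volume_form_neq_0[OF perm] by (simp add: \<omega>_def)
  ultimately show "\<theta> (units ks) = 0" using 0[OF \<omega>] js ks block_factor_pos[of j m] by simp
qed

lemma wedge_diff_right: "wedge j m \<omega> (\<theta> - \<theta>') = wedge j m \<omega> \<theta> - wedge j m \<omega> \<theta>'"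
  by (auto simp: wedge_def fun_eq_iff algebra_simps sum_subtractf diff_divide_distrib)

lemma hodge_star_eq:
  fixes \<eta> :: "(real^'n::{finite,linorder}) form"
  assumes \<eta>: "\<eta> \<in> Alt j" and jm: "j + m = CARD('n)"
  shows "hodge_star j \<eta> = hodge_sum j \<eta>"
proof -
  have m: "CARD('n) - j = m" using jm by simp
  show ?thesis
    unfolding hodge_star_def m
  proof (rule the_equality)
    show "hodge_sum j \<eta> \<in> Alt m \<and>
        (\<forall>\<omega>\<in>Alt j. wedge j m \<omega> (hodge_sum j \<eta>) = form_inner j \<omega> \<eta> *\<^sub>R volume_form)"
      using hodge_sum_in_Alt[OF jm] wedge_hodge_sum[OF _ \<eta> jm] by blast
    fix \<theta> assume \<theta>: "\<theta> \<in> Alt m \<and> (\<forall>\<omega>\<in>Alt j. wedge j m \<omega> \<theta> = form_inner j \<omega> \<eta> *\<^sub>R volume_form)"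
    have "\<theta> - hodge_sum j \<eta> = 0"
    proof (rule wedge_nondegenerate[OF _ jm])
      show "\<theta> - hodge_sum j \<eta> \<in> Alt m"
        using \<theta> hodge_sum_in_Alt[OF jm] by (intro subspace_diff subspace_Alt) auto
    qed (use \<theta> wedge_hodge_sum[OF _ \<eta> jm] in \<open>simp add: wedge_diff_right\<close>)
    then show "\<theta> = hodge_sum j \<eta>" by simp
  qed
qed

lemma form_inner_hodge_star:
  fixes \<alpha> \<eta> :: "(real^'n::{finite,linorder}) form"
  assumes "\<alpha> \<in> Alt m" "\<eta> \<in> Alt j" "j + m = CARD('n)"
  shows "form_inner m \<alpha> (hodge_star j \<eta>)
    = wedge j m \<eta> \<alpha> (units coords) * volume_form (units (coords :: 'n list))"
  using hodge_star_eq[OF assms(2,3)] form_inner_hodge_sum[OF assms] by simp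

section \<open>Double forms\<close>

lemma tensor_in_Alt2: "\<alpha> \<in> Alt j \<Longrightarrow> \<beta> \<in> Alt m \<Longrightarrow> tensor \<alpha> \<beta> \<in> Alt2 j m"
  unfolding Alt2_def by (rule span_base) blast

text \<open>Double forms whose slices are all alternating form a subspace that contains the tensors.
  Through slices, results on single forms apply to each slot.\<close>

lemma Alt2_slices:
  fixes \<omega> :: "'a::real_vector biform"
  assumes "\<omega> \<in> Alt2 j m"
  shows "(\<lambda>ws. \<omega> ws vs) \<in> Alt j" and "\<omega> ws \<in> Alt m"
proof -
  let ?W = "{\<omega> :: 'a biform. (\<forall>vs. (\<lambda>ws. \<omega> ws vs) \<in> Alt j) \<and> (\<forall>ws. \<omega> ws \<in> Alt m)}"
  have "(\<lambda>ws. \<alpha> ws * \<beta> vs) \<in> Alt j" if "\<alpha> \<in> Alt j" for \<alpha> :: "'a form" and \<beta> :: "'a form" and vs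
  proof -
    have "(\<lambda>ws. \<alpha> ws * \<beta> vs) = \<beta> vs *\<^sub>R \<alpha>" by (auto simp: scaleR_fun_def)
    then show ?thesis using subspace_scale[OF subspace_Alt that] by simp
  qed
  moreover have "(\<lambda>vs. \<alpha> ws * \<beta> vs) \<in> Alt m" if "\<beta> \<in> Alt m" for \<alpha> :: "'a form" and \<beta> :: "'a form" and ws
  proof -
    have "(\<lambda>vs. \<alpha> ws * \<beta> vs) = \<alpha> ws *\<^sub>R \<beta>" by (auto simp: scaleR_fun_def)
    then show ?thesis using subspace_scale[OF subspace_Alt that] by simp
  qed
  ultimately have "{tensor \<alpha> \<beta> | \<alpha> \<beta>. \<alpha> \<in> Alt j \<and> \<beta> \<in> Alt m} \<subseteq> ?W"
    by (auto simp: tensor_def)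
  moreover have "subspace ?W"
    using subspace_Alt[of j] subspace_Alt[of m]
    by (auto simp: subspace_def zero_fun_def plus_fun_def scaleR_fun_def)
  ultimately have "Alt2 j m \<subseteq> ?W" unfolding Alt2_def by (rule span_minimal)
  then show "(\<lambda>ws. \<omega> ws vs) \<in> Alt j" "\<omega> ws \<in> Alt m" using assms by auto
qed

text \<open>Pairing with a tensor can be done one slot at a time, the right one first.\<close>

lemma biform_inner_slices:
  "biform_inner j m \<omega> (tensor \<alpha> \<beta>)
    = form_inner j (\<lambda>ws. form_inner m (\<omega> ws) \<beta>) \<alpha>"
  by (simp add: biform_inner_def form_inner_def tensor_def sum_distrib_left sum_distrib_right mult_ac)

lemma nth_update_drop_take:
  assumes "i < length vs" "l < length vs" "i \<noteq> l"
  shows "take i (vs[l := x]) @ drop (Suc i) (vs[l := x])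
    = (take i vs @ drop (Suc i) vs)[(if l < i then l else l - 1) := x]"
  using assms
  by (cases "l < i") (auto simp: list_update_append take_update_swap drop_update_swap list_update_beyond)

text \<open>The function is \<open>g \<and> \<beta>\<close> by Laplace expansion.\<close>

lemma laplace_in_Alt:
  assumes g: "linear g" and \<beta>: "\<beta> \<in> Alt m"
  shows "(\<lambda>vs. \<Sum>i<length vs. (- 1) ^ i * g (vs ! i) * \<beta> (take i vs @ drop (Suc i) vs)) \<in> Alt (Suc m)"
    (is "?f \<in> _")
  unfolding Alt_def
proof (intro CollectI conjI allI impI)
  fix vs :: "'a list" assume "length vs \<noteq> Suc m"
  then show "?f vs = 0"
    using Alt_length[OF \<beta>] by (intro sum.neutral) force
next
  fix vs :: "'a list" and l assume vs: "length vs = Suc m \<and> l < Suc m"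
  have "linear (\<lambda>x. (- 1) ^ i * g (vs[l := x] ! i) * \<beta> (take i (vs[l := x]) @ drop (Suc i) (vs[l := x])))"
    if i: "i < length vs" for i
  proof (cases "i = l")
    case True
    then show ?thesis using vs g by (simp add: linear_iff algebra_simps)
  next
    case False
    have "linear (\<lambda>x. \<beta> ((take i vs @ drop (Suc i) vs)[(if l < i then l else l - 1) := x]))"
      by (rule Alt_linear_update[OF \<beta>]) (use vs i False in auto)
    then show ?thesis using False vs i
      by (simp add: nth_update_drop_take nth_list_update linear_iff algebra_simps)
  qed
  then have "linear (\<lambda>x. \<Sum>i<length vs. (- 1) ^ i * g (vs[l := x] ! i)
      * \<beta> (take i (vs[l := x]) @ drop (Suc i) (vs[l := x])))"
    by (intro linear_compose_sum) auto
  then show "linear (\<lambda>x. ?f (vs[l := x]))" by simp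
next
  fix vs :: "'a list" and a b
  assume vs: "length vs = Suc m \<and> a < b \<and> b < Suc m \<and> vs ! a = vs ! b"
  define A B C x where "A = take a vs" and "B = drop (Suc a) (take b vs)" and "C = drop (Suc b) vs"
    and "x = vs ! a"
  have "vs = take b vs @ x # C"
    using vs by (simp add: C_def x_def id_take_nth_drop[symmetric])
  moreover have "take b vs = A @ x # B"
    using vs id_take_nth_drop[of a "take b vs"] by (simp add: A_def B_def x_def min_def)
  ultimately have vs_eq: "vs = A @ x # B @ x # C" by simp
  have A: "length A = a" and B: "length B = b - Suc a" using vs by (auto simp: A_def B_def)
  \<comment> \<open>Moving \<open>x\<close> past \<open>B'\<close> takes one transposition per
    entry.\<close>
  have mv: "\<beta> (A @ x # B' @ C') = (- 1) ^ length B' * \<beta> (A @ B' @ x # C')" for B' C'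
  proof (induction B' arbitrary: C' rule: rev_induct)
    case (snoc y B')
    show ?case
      using snoc.IH[of "y # C'"] Alt_swap[OF \<beta>, of "A @ B'" x "[]" y C'] by simp
  qed simp
  let ?t = "\<lambda>i. (- 1) ^ i * g (vs ! i) * \<beta> (take i vs @ drop (Suc i) vs)"
  \<comment> \<open>Deleting a position other than \<open>a\<close> and \<open>b\<close> keeps both
    equal arguments; the index formula below locates them in the shortened list.\<close>
  have "?t i = 0" if i: "i \<in> {..<length vs} - {a, b}" for i
  proof -
    have "\<not> distinct (take i vs @ drop (Suc i) vs)"
    proof
      assume d: "distinct (take i vs @ drop (Suc i) vs)"
      have "(take i vs @ drop (Suc i) vs) ! (if l < i then l else l - 1) = vs ! l"
        if "l \<noteq> i" "l < length vs" for l
        using that i by (auto simp: nth_append)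
      from this[of a] this[of b]
      have "(if a < i then a else a - 1) = (if b < i then b else b - 1)"
        using d i vs by (subst nth_eq_iff_index_eq[OF d, symmetric]) auto
      then show False using vs i by (auto split: if_splits)
    qed
    then show ?thesis using Alt_not_distinct[OF \<beta>] by simp
  qed
  then have "?f vs = sum ?t {a, b}"
    using vs by (intro sum.mono_neutral_right) auto
  also have "\<dots> = ?t a + ?t b" using vs by simp
  also have "take a vs @ drop (Suc a) vs = A @ B @ x # C"
    using A by (simp add: vs_eq)
  also have "take b vs @ drop (Suc b) vs = A @ x # B @ C"
    using A B vs by (simp add: C_def \<open>take b vs = A @ x # B\<close>)
  also have "(- 1) ^ a * g (vs ! a) * \<beta> (A @ B @ x # C) + (- 1) ^ b * g (vs ! b) * \<beta> (A @ x # B @ C) = 0"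
  proof -
    \<comment> \<open>The two surviving terms differ by moving \<open>x\<close> across
      \<open>B\<close>; together with the alternating sign this is an odd power of -1, so they
      cancel.\<close>
    have "b = Suc (a + length B)" using B vs by simp
    then have "(- 1) ^ b * (- 1) ^ length B = - ((- 1 :: real) ^ a)"
      by (simp add: power_add mult.assoc flip: power_mult_distrib)
    then have "(- 1) ^ b * ((- 1) ^ length B * y) = - ((- 1) ^ a * y)" for y :: real
      by (metis mult.assoc mult_minus_left)
    from this[of "g (vs ! b) * \<beta> (A @ B @ x # C)"] show ?thesis using vs by (simp add: mv mult_ac)
  qed
  finally show "?f vs = 0" .
qed

text \<open>The contraction of \<open>f\<close> with \<open>c\<close> is alternating and vanishes by
  \<open>Alt_eq_0_on_span\<close>; an occurrence of \<open>c\<close> elsewhere is first moved to the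
  front.\<close>

lemma Alt_eq_0_if_mem:
  assumes f: "f \<in> Alt j" and B: "span B = UNIV" and "c \<in> set vs"
    and 0: "\<And>vs. set vs \<subseteq> B \<Longrightarrow> distinct vs \<Longrightarrow> length vs = j \<Longrightarrow> c \<in> set vs \<Longrightarrow> f vs = 0"
    and "c \<in> B"
  shows "f vs = 0"
proof (cases j)
  case 0
  then show ?thesis using Alt_length[OF f, of vs] \<open>c \<in> set vs\<close> by (cases "f vs = 0") auto
next
  case (Suc l)
  have "(\<lambda>vs. f ([c] @ vs @ [])) = 0"
  proof (rule Alt_eq_0_on_span[OF Alt_append_middle B])
    show "f \<in> Alt (length [c] + l + length [])" using f Suc by simp
    fix vs assume "set vs \<subseteq> B" "length vs = l"
    then show "f ([c] @ vs @ []) = 0"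
      using 0[of "c # vs"] Alt_not_distinct[OF f, of "c # vs"] \<open>c \<in> B\<close> Suc by fastforce
  qed
  then have *: "f (c # ws) = 0" for ws by (simp add: fun_eq_iff)
  obtain as bs where vs: "vs = as @ c # bs" using \<open>c \<in> set vs\<close> by (meson split_list)
  have "mset (c # as @ bs) = mset vs" using vs by simp
  then show ?thesis using Alt_mset_cong[OF f _ *] by blast
qed

text \<open>Expanding by linearity, every term that contains \<open>c\<close> drops out. The purpose
  is a change of base vertex: edges at another vertex are differences of edges at the old
  one.\<close>

lemma Alt_map_diff:
  assumes f: "f \<in> Alt j" and 0: "\<And>vs. c \<in> set vs \<Longrightarrow> f vs = 0"
  shows "f (map (\<lambda>x. x - c) vs) = f vs"
proof -
  have "\<forall>bs. f (map (\<lambda>x. x - c) as @ bs) = f (as @ bs)" for as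
  proof (induction as rule: rev_induct)
    case (snoc x as)
    show ?case
    proof
      fix bs
      have "f (map (\<lambda>x. x - c) as @ (x - c) # bs)
          = f (map (\<lambda>x. x - c) as @ x # bs) - f (map (\<lambda>x. x - c) as @ c # bs)"
        by (rule linear_diff[OF Alt_linear[OF f]])
      then show "f (map (\<lambda>x. x - c) (as @ [x]) @ bs) = f ((as @ [x]) @ bs)"
        using 0[of "map (\<lambda>x. x - c) as @ c # bs"] snoc by simp
    qed
  qed simp
  from this[rule_format, of vs "[]"] show ?thesis by simp
qed

section \<open>Forms on a simplex\<close>

text \<open>The differentiated content of barycentric coordinates. By \<open>D_edge\<close> the
  differentials are dual to the edges issuing from any vertex; \<open>sum_D\<close> and
  \<open>expand_D\<close> are the derivatives of the two defining identities.\<close>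

locale barycentric =
  fixes a :: "nat \<Rightarrow> real^'n::{finite,linorder}" and lam :: "nat \<Rightarrow> real^'n::_ \<Rightarrow> real"
    and D :: "nat \<Rightarrow> real^'n::_ \<Rightarrow> real" and n :: nat
  defines "D j \<equiv> frechet_derivative (lam j) (at 0)"
  assumes n: "n = CARD('n)"
    and linear_D: "j \<le> n \<Longrightarrow> linear (D j)"
    and D_edge: "j \<le> n \<Longrightarrow> x \<le> n \<Longrightarrow> y \<le> n \<Longrightarrow> D j (a x - a y) = of_bool (j = x) - of_bool (j = y)"
    and sum_D: "(\<Sum>j\<le>n. D j v) = 0"
    and expand_D: "(\<Sum>j\<le>n. D j v *\<^sub>R a j) = v"
begin

abbreviation edge :: "nat \<Rightarrow> nat \<Rightarrow> real^'n::_"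
  where "edge q x \<equiv> a x - a q"

lemma span_edges: "span (edge q ` ({..n} - {q})) = UNIV"
proof -
  have "v \<in> span (edge q ` ({..n} - {q}))" for v
  proof -
    \<comment> \<open>By \<open>sum_D\<close> the coefficients add up to zero, so subtracting
      \<open>a q\<close> from every vertex changes nothing.\<close>
    have "v = (\<Sum>j\<le>n. D j v *\<^sub>R edge q j)"
      using expand_D[of v] sum_D[of v]
      by (simp add: scaleR_diff_right sum_subtractf flip: scaleR_sum_left)
    also have "\<dots> \<in> span (edge q ` ({..n} - {q}))"
    proof (rule span_sum)
      fix j assume "j \<in> {..n}"
      then show "D j v *\<^sub>R edge q j \<in> span (edge q ` ({..n} - {q}))"
        by (cases "j = q") (auto intro: span_scale span_base span_zero)
    qed
    finally show ?thesis .
  qed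
  then show ?thesis by blast
qed

lemma inj_edge: "q \<le> n \<Longrightarrow> inj_on (edge q) {..n}"
proof (rule inj_onI)
  fix x y assume "q \<le> n" "x \<in> {..n}" "y \<in> {..n}" "edge q x = edge q y"
  then show "x = y" using D_edge[of x x q] D_edge[of x y q] by (auto split: if_splits)
qed

lemma dlam_alt_def: "dlam lam S = wedge_list (map covector (map D (sorted_list_of_set S)))"
  by (simp add: dlam_def D_def comp_def)

lemma dlam_in_Alt:
  assumes "S \<subseteq> {..n}"
  shows "dlam lam S \<in> Alt (card S)"
proof -
  have "finite S" using assms finite_subset by blast
  then show ?thesis
    unfolding dlam_alt_def
    using wedge_list_in_Alt[of "map D (sorted_list_of_set S)"] linear_D assms by auto
qed

lemma wedge_list_edges:
  assumes "distinct xs" "set xs \<subseteq> {..n} - {q}" "q \<le> n"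
  shows "wedge_list (map covector (map D xs)) (map (edge q) xs) \<noteq> 0"
proof (rule wedge_list_dual_neq_0)
  fix i l assume "i < length (map D xs)" "l < length (map D xs)"
  then have il: "i < length xs" "l < length xs" by auto
  then have "xs ! i \<le> n" "xs ! l \<le> n" "xs ! i \<noteq> q"
    using subsetD[OF assms(2) nth_mem[of i xs]] subsetD[OF assms(2) nth_mem[of l xs]] by auto
  then show "(map D xs ! i) (map (edge q) xs ! l) = (if i = l then 1 else 0)"
    using il assms(1,3) D_edge[of "xs ! i" "xs ! l" q] by (simp add: nth_eq_iff_index_eq)
qed (use assms linear_D in auto)

lemma dlam_eq_0:
  assumes "s \<in> S" "finite S" "\<And>v. v \<in> set vs \<Longrightarrow> D s v = 0"
  shows "dlam lam S vs = 0"
  unfolding dlam_alt_def using assms by (intro wedge_list_eq_0[of "D s"]) auto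

lemma dlam_eq_0':
  assumes "v \<in> set vs" "finite S" "\<And>s. s \<in> S \<Longrightarrow> D s v = 0"
  shows "dlam lam S vs = 0"
  unfolding dlam_alt_def using assms by (intro wedge_list_eq_0'[of v]) auto

section \<open>Pairings with starred wedges of differentials, read off on edges\<close>

lemma volume_form_edges:
  assumes "distinct xs" "set xs = {..n} - {q}" "q \<le> n"
  shows "volume_form (map (edge q) xs) \<noteq> 0"
proof -
  let ?g = "wedge_list (map covector (map D xs))"
  have "length xs = n" using assms distinct_card[of xs] by simp
  then have "?g \<in> Alt CARD('n)"
    using wedge_list_in_Alt[of "map D xs"] linear_D assms(2) n by auto
  note top = Alt_top_proportional[OF this volume_form_in_Alt, of "map (edge q) xs"]
  have "?g (map (edge q) xs) \<noteq> 0" using assms by (intro wedge_list_edges) auto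
  then have "?g (map (edge q) xs) * volume_form (units (coords :: 'n list)) \<noteq> 0"
    using volume_form_coords[where 'n='n] by simp
  then show ?thesis unfolding top by simp
qed

text \<open>The pairing is the wedge of \<open>dlam lam R\<close> with \<alpha>, a top-degree form,
  and can be evaluated on the edges at \<open>q\<close> instead of the coordinate vectors. With the
  edges to \<open>R\<close> listed first, the differentials of \<open>R\<close> are dual to the
  first block and vanish on the second, so \<open>wedge_block\<close> leaves \<alpha> on the edges
  \<open>ts\<close>.\<close>

lemma form_inner_star_dlam:
  assumes R: "R \<subseteq> {..n}" and q: "q \<le> n" "q \<notin> R" and ts: "distinct ts" "set ts = {..n} - R - {q}"
  shows "\<exists>c. c \<noteq> 0 \<and> (\<forall>\<alpha>\<in>Alt (length ts).
    form_inner (length ts) \<alpha> (hodge_star (card R) (dlam lam R)) = c * \<alpha> (map (edge q) ts))"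
proof -
  define rs where "rs = sorted_list_of_set R"
  have fR: "finite R" using R finite_subset by blast
  have rs: "set rs = R" "distinct rs" "length rs = card R" using fR by (auto simp: rs_def)
  have "distinct (rs @ ts)" "set (rs @ ts) = {..n} - {q}" using rs ts R q by auto
  note all = this
  then have "card R + length ts = card ({..n} - {q})"
    using rs distinct_card[OF all(1)] by simp
  then have jm: "card R + length ts = CARD('n)" using q n by simp
  let ?us = "map (edge q) rs" and ?ws = "map (edge q) ts"
  let ?dl = "dlam lam R"
  let ?v = "volume_form (units (coords :: 'n list))"
  have V: "volume_form (?us @ ?ws) \<noteq> 0" using volume_form_edges[OF all] q by simp
  have dl: "?dl \<in> Alt (card R)" by (rule dlam_in_Alt[OF R])
  have dl0: "?dl ?us \<noteq> 0" unfolding dlam_alt_def rs_def[symmetric]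
    by (rule wedge_list_edges) (use rs R q in auto)
  \<comment> \<open>The quotient by the value on the edges, with one factor \<open>?v\<close>, is
    the change from edges to coordinates; the other \<open>?v\<close> comes from
    \<open>form_inner_hodge_star\<close>.\<close>
  define c where "c = block_factor (card R) (length ts) * ?dl ?us * ?v * ?v / volume_form (?us @ ?ws)"
  have "form_inner (length ts) \<alpha> (hodge_star (card R) ?dl) = c * \<alpha> ?ws" if \<alpha>: "\<alpha> \<in> Alt (length ts)" for \<alpha>
  proof -
    let ?w = "wedge (card R) (length ts) ?dl \<alpha>"
    have "wedge (length ?us) (length ?ws) ?dl \<alpha> (?us @ ?ws)
        = block_factor (length ?us) (length ?ws) * ?dl ?us * \<alpha> ?ws"
    proof (rule wedge_block)
      show "?dl \<in> Alt (length ?us)" "\<alpha> \<in> Alt (length ?ws)" using dl \<alpha> rs by auto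
      fix p assume p: "p permutes {..<length ?us + length ?ws}" "\<not> p ` {..<length ?us} \<subseteq> {..<length ?us}"
      \<comment> \<open>By counting, a permutation that does not preserve the first block misses one
        of its positions \<open>l\<close>. The differential at \<open>rs ! l\<close> then kills
        every edge placed in that block.\<close>
      have "\<not> {..<length ?us} \<subseteq> p ` {..<length ?us}"
      proof
        assume "{..<length ?us} \<subseteq> p ` {..<length ?us}"
        then have "{..<length ?us} = p ` {..<length ?us}"
          by (intro card_subset_eq) (auto simp: card_image permutes_inj_on[OF p(1)])
        then show False using p(2) by simp
      qed
      then obtain l where l: "l < length rs" "l \<notin> p ` {..<length rs}" by auto
      let ?L = "map (\<lambda>i. (?us @ ?ws) ! p i) [0..<length ?us]"
      have "?dl ?L = 0"
      proof (rule dlam_eq_0)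
        show "rs ! l \<in> R" using l rs by auto
        fix v assume "v \<in> set ?L"
        then obtain i where i: "i < length rs" "v = (?us @ ?ws) ! p i" by auto
        have pi: "p i < length (rs @ ts)" using permutes_in_image[OF p(1), of i] i by simp
        have v: "v = edge q ((rs @ ts) ! p i)" using i(2) pi by (simp only: nth_map flip: map_append)
        have "l \<noteq> p i" using l i by auto
        moreover have rsl: "rs ! l = (rs @ ts) ! l" using l(1) by (simp add: nth_append)
        ultimately have "rs ! l \<noteq> (rs @ ts) ! p i"
          using nth_eq_iff_index_eq[OF all(1), of l "p i"] l(1) pi by simp
        moreover have "rs ! l \<in> {..n} - {q}" "(rs @ ts) ! p i \<in> {..n} - {q}"
          unfolding rsl all(2)[symmetric] using l(1) pi by (auto intro!: nth_mem simp del: set_append)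
        ultimately show "D (rs ! l) v = 0"
          using v q(1) D_edge[of "rs ! l" "(rs @ ts) ! p i" q] by simp
      qed (rule fR)
      then show "?dl ?L = 0 \<or> \<alpha> (map (\<lambda>i. (?us @ ?ws) ! p i)
          [length ?us..<length ?us + length ?ws]) = 0" by blast
    qed
    then have w: "?w (?us @ ?ws) = block_factor (card R) (length ts) * ?dl ?us * \<alpha> ?ws"
      using rs by simp
    have "?w \<in> Alt CARD('n)" using wedge_in_Alt[OF dl \<alpha>] jm by simp
    then have "?w (?us @ ?ws) * ?v = ?w (units coords) * volume_form (?us @ ?ws)"
      by (rule Alt_top_proportional[OF _ volume_form_in_Alt])
    then have "?w (units coords) = ?w (?us @ ?ws) * ?v / volume_form (?us @ ?ws)"
      by (simp only: nonzero_mult_div_cancel_right[OF V])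
    then show ?thesis
      unfolding form_inner_hodge_star[OF \<alpha> dl jm] w by (simp add: c_def)
  qed
  moreover have "c \<noteq> 0"
    using V dl0 volume_form_coords[where 'n='n] block_factor_pos[of "card R" "length ts"]
    by (simp add: c_def)
  ultimately show ?thesis by blast
qed

text \<open>If \<open>A\<close> and \<open>B\<close> are disjoint, exactly one vertex
  \<open>q\<close> remains and the pairing is a multiple of \<open>dlam lam A\<close> on its dual
  edges at \<open>q\<close>. A common vertex \<open>s\<close> is touched by none of the edges used,
  so its differential annihilates them all.\<close>

lemma form_inner_dlam_star:
  assumes A: "A \<subseteq> {..n}" and B: "B \<subseteq> {..n}" and card: "card A + card B = n"
  shows "form_inner (card A) (dlam lam A) (hodge_star (card B) (dlam lam B)) \<noteq> 0 \<longleftrightarrow> A \<inter> B = {}"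
proof -
  have fin: "finite A" "finite B" using A B finite_subset by blast+
  \<comment> \<open>There are \<open>n + 1\<close> vertices, and the sizes of \<open>A\<close> and
    \<open>B\<close> add up to \<open>n\<close> only.\<close>
  have ex: "\<exists>q\<in>{..n}. q \<notin> B \<and> (A \<inter> B = {} \<longrightarrow> q \<notin> A)"
  proof (rule ccontr)
    assume "\<not> ?thesis"
    then have "{..n} \<subseteq> (if A \<inter> B = {} then A \<union> B else B)" by auto
    then have "Suc n \<le> card (if A \<inter> B = {} then A \<union> B else B)"
      using fin card_mono[of "if A \<inter> B = {} then A \<union> B else B" "{..n}"] by (simp split: if_splits)
    then have "A \<inter> B \<noteq> {}" "card B = Suc n \<or> card A = 0"
      using card card_Un_disjoint[OF fin] by (auto split: if_splits)
    then show False using card fin \<open>Suc n \<le> _\<close> by auto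
  qed
  then obtain q where q: "q \<le> n" "q \<notin> B" "A \<inter> B = {} \<Longrightarrow> q \<notin> A" by auto
  define ts where "ts = sorted_list_of_set ({..n} - B - {q})"
  have ts: "distinct ts" "set ts = {..n} - B - {q}" by (auto simp: ts_def)
  have cardts: "card ({..n} - B - {q}) = card A"
    using card q fin B by (simp add: card_Diff_subset)
  then have len: "length ts = card A" by (simp add: ts_def)
  obtain c where c: "c \<noteq> 0" "\<forall>\<alpha>\<in>Alt (card A).
      form_inner (card A) \<alpha> (hodge_star (card B) (dlam lam B)) = c * \<alpha> (map (edge q) ts)"
    using form_inner_star_dlam[OF B q(1,2) ts] len by auto
  have *: "form_inner (card A) (dlam lam A) (hodge_star (card B) (dlam lam B)) = c * dlam lam A (map (edge q) ts)"
    using c(2) dlam_in_Alt[OF A] by blast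
  show ?thesis
  proof (cases "A \<inter> B = {}")
    case True
    then have "A = {..n} - B - {q}"
      using cardts A q by (intro card_subset_eq) auto
    then have "sorted_list_of_set A = ts" by (simp add: ts_def)
    moreover have "wedge_list (map covector (map D ts)) (map (edge q) ts) \<noteq> 0"
      using ts q by (intro wedge_list_edges) auto
    ultimately have "dlam lam A (map (edge q) ts) \<noteq> 0"
      unfolding dlam_alt_def by simp
    then show ?thesis using True c * by simp
  next
    case False
    then obtain s where s: "s \<in> A" "s \<in> B" by auto
    have "dlam lam A (map (edge q) ts) = 0"
    proof (rule dlam_eq_0[OF s(1) fin(1)])
      fix v assume "v \<in> set (map (edge q) ts)"
      then obtain x where "x \<le> n" "x \<notin> B" "v = edge q x" using ts by auto
      then show "D s v = 0" using D_edge[of s x q] s B q by auto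
    qed
    then show ?thesis using False * by simp
  qed
qed

text \<open>Applying \<open>form_inner_star_dlam\<close> in each slot gives a nonzero multiple of
  the value on edges. The base vertices of the two slots are independent of each other, a freedom
  exploited in \<open>XX_eq_0\<close>.\<close>

lemma biform_inner_star_dlam:
  assumes "R \<subseteq> {..n}" "q \<le> n" "q \<notin> R" "distinct ts" "set ts = {..n} - R - {q}"
    and "R' \<subseteq> {..n}" "q' \<le> n" "q' \<notin> R'" "distinct ts'" "set ts' = {..n} - R' - {q'}"
    and "length ts = j" "length ts' = m"
    and \<omega>: "\<omega> \<in> Alt2 j m"
  shows "biform_inner j m \<omega> (tensor (hodge_star (card R) (dlam lam R)) (hodge_star (card R') (dlam lam R'))) = 0
    \<longleftrightarrow> \<omega> (map (edge q) ts) (map (edge q') ts') = 0"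
proof -
  let ?\<alpha> = "hodge_star (card R) (dlam lam R)" and ?\<beta> = "hodge_star (card R') (dlam lam R')"
  obtain c where c: "c \<noteq> 0" "\<forall>\<alpha>\<in>Alt j. form_inner j \<alpha> ?\<alpha> = c * \<alpha> (map (edge q) ts)"
    using form_inner_star_dlam[OF assms(1-5)] assms(11) by auto
  obtain c' where c': "c' \<noteq> 0" "\<forall>\<alpha>\<in>Alt m. form_inner m \<alpha> ?\<beta> = c' * \<alpha> (map (edge q') ts')"
    using form_inner_star_dlam[OF assms(6-10)] assms(12) by auto
  have "(\<lambda>ws. form_inner m (\<omega> ws) ?\<beta>) = c' *\<^sub>R (\<lambda>ws. \<omega> ws (map (edge q') ts'))"
    using c'(2) Alt2_slices(2)[OF \<omega>] by (auto simp: scaleR_fun_def)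
  also have "\<dots> \<in> Alt j" by (intro subspace_scale subspace_Alt Alt2_slices[OF \<omega>])
  finally have "biform_inner j m \<omega> (tensor ?\<alpha> ?\<beta>)
      = c * (c' * \<omega> (map (edge q) ts) (map (edge q') ts'))"
    unfolding biform_inner_slices using c(2) c'(2) Alt2_slices(2)[OF \<omega>] by simp
  then show ?thesis using c c' by simp
qed

section \<open>Membership in the kernel of \<open>s_map\<close>, and what determines its
  elements\<close>

text \<open>For fixed \<open>ws\<close> the image under \<open>s_map\<close> is the Laplace
  expansion of a covector \<open>g\<close> wedged with the right factor, and it suffices to test
  edges at \<open>q\<close>. The edge to \<open>r\<close> is killed by \<open>g\<close>, since
  \<open>S\<close> avoids \<open>q\<close> and \<open>r\<close>; deleting the edge to any other
  vertex leaves only edges killed by the differential of that vertex.\<close>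

lemma tensor_dlam_in_XX:
  assumes S: "S \<subseteq> {..n} - {q, r}" and q: "q \<le> n" and r: "r \<le> n" "r \<noteq> q"
  shows "tensor (dlam lam S) (dlam lam ({..n} - {q, r})) \<in> XX (card S)"
proof -
  let ?R = "{..n} - {q, r}"
  let ?\<beta> = "dlam lam ?R"
  have "card ({..n} - {q, r}) = card {..n} - card {q, r}" using q r by (intro card_Diff_subset) auto
  then have R: "card ?R = n - 1" using r by simp
  have fS: "finite S" using S finite_subset by blast
  have \<alpha>: "dlam lam S \<in> Alt (card S)" using S by (intro dlam_in_Alt) auto
  have \<beta>: "?\<beta> \<in> Alt (n - 1)" using dlam_in_Alt[of ?R] R by auto
  have "s_map (tensor (dlam lam S) ?\<beta>) ws = 0" for ws
  proof -
    define g where "g v = dlam lam S (v # ws)" for v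
    have g: "linear g" using Alt_linear[OF \<alpha>, of "[]" ws] unfolding g_def by simp
    have s: "s_map (tensor (dlam lam S) ?\<beta>) ws
        = (\<lambda>vs. \<Sum>i<length vs. (- 1) ^ i * g (vs ! i) * ?\<beta> (take i vs @ drop (Suc i) vs))"
      by (simp add: s_map_def tensor_def g_def fun_eq_iff mult.assoc)
    show ?thesis
      unfolding s
    proof (rule Alt_eq_0_on_span[OF laplace_in_Alt[OF g \<beta>] span_edges[of q]])
      fix vs assume vs: "set vs \<subseteq> edge q ` ({..n} - {q})" "distinct vs" "length vs = Suc (n - 1)"
      obtain xs where xs: "vs = map (edge q) xs" "set xs \<subseteq> {..n} - {q}"
      proof -
        have "vs \<in> lists (edge q ` ({..n} - {q}))" using vs(1) by auto
        then show thesis using that unfolding lists_image by auto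
      qed
      have dxs: "distinct xs" using vs xs by (simp add: distinct_map)
      show "(\<Sum>i<length vs. (- 1) ^ i * g (vs ! i) * ?\<beta> (take i vs @ drop (Suc i) vs)) = 0"
      proof (rule sum.neutral, rule ballI)
        fix i assume "i \<in> {..<length vs}"
        then have i: "i < length xs" using xs by simp
        then have x: "xs ! i \<le> n" "xs ! i \<noteq> q" using subsetD[OF xs(2) nth_mem[OF i]] by auto
        show "(- 1) ^ i * g (vs ! i) * ?\<beta> (take i vs @ drop (Suc i) vs) = 0"
        proof (cases "xs ! i = r")
          case True
          have "g (vs ! i) = 0"
            unfolding g_def
          proof (rule dlam_eq_0'[OF _ fS])
            show "vs ! i \<in> set (vs ! i # ws)" by simp
            fix t assume "t \<in> S"
            then show "D t (vs ! i) = 0" using S True i xs(1) r q D_edge[of t r q] by auto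
          qed
          then show ?thesis by simp
        next
          case False
          have "?\<beta> (take i vs @ drop (Suc i) vs) = 0"
          proof (rule dlam_eq_0)
            show "xs ! i \<in> ?R" using x False by simp
            fix v assume "v \<in> set (take i vs @ drop (Suc i) vs)"
            then obtain y where y: "y \<in> set (take i xs) \<union> set (drop (Suc i) xs)" "v = edge q y"
              using xs(1) by (auto simp: take_map drop_map)
            have "distinct (take i xs @ xs ! i # drop (Suc i) xs)"
              using dxs id_take_nth_drop[OF i] by simp
            then have "y \<noteq> xs ! i" using y(1) by auto
            moreover have "y \<in> set xs"
              using y(1) by (auto dest: in_set_takeD in_set_dropD)
            ultimately show "D (xs ! i) v = 0" using y(2) x xs(2) q D_edge[of "xs ! i" y q] by auto
          qed simp
          then show ?thesis by simp
        qed
      qed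
    qed
  qed
  then show ?thesis
    unfolding XX_def using tensor_in_Alt2[OF \<alpha> \<beta>] n by (auto simp: fun_eq_iff)
qed

text \<open>The unprojected second family separates the points of the kernel. The condition
  \<open>m \<noteq> Min \<tau>\<close> matches the index range starting at 1, as
  \<open>\<sigma> 0\<close> is the least vertex in the range of \<sigma>.\<close>

lemma XX_eq_0:
  assumes \<omega>: "\<omega> \<in> XX k" and k: "1 \<le> k" "k \<le> n - 1"
    and 0: "\<And>\<tau> m. \<tau> \<subseteq> {..n} \<Longrightarrow> card \<tau> = n - k + 1 \<Longrightarrow> m \<in> \<tau> \<Longrightarrow> m \<noteq> Min \<tau> \<Longrightarrow>
      biform_inner k (n - 1) \<omega>
        (tensor (hodge_star (n - k) (dlam lam (\<tau> - {m}))) (hodge_star 1 (dlam lam {m}))) = 0"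
  shows "\<omega> = 0"
proof -
  have \<omega>2: "\<omega> \<in> Alt2 k (n - 1)" and s: "s_map \<omega> = 0" using \<omega> n by (auto simp: XX_def)
  have n2: "n \<ge> 2" using k by simp
  let ?p = "\<lambda>\<tau> m. biform_inner k (n - 1) \<omega>
    (tensor (hodge_star (n - k) (dlam lam (\<tau> - {m}))) (hodge_star 1 (dlam lam {m})))"
  \<comment> \<open>Here \<open>q\<close> is any of the \<open>k + 1\<close> vertices outside
    \<open>\<tau> - {m}\<close>, leaving \<open>k\<close> edges, and \<open>q'\<close> is any vertex
    of the facet opposite to \<open>m\<close>.\<close>
  have pair: "?p \<tau> m = 0 \<longleftrightarrow> \<omega> (map (edge q) ts) (map (edge q') ts') = 0"
    if "\<tau> \<subseteq> {..n}" "card \<tau> = n - k + 1" "m \<in> \<tau>"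
      "distinct (q # ts)" "set (q # ts) = {..n} - (\<tau> - {m})"
      "distinct (q' # ts')" "set (q' # ts') = {..n} - {m}" for \<tau> m q ts q' ts'
  proof -
    have fin: "finite \<tau>" using that(1) finite_subset by blast
    have cR: "card (\<tau> - {m}) = n - k" using that(2,3) fin by simp
    have "card ({..n} - (\<tau> - {m})) = Suc n - (n - k)"
      using that(1) fin cR by (subst card_Diff_subset) auto
    then have "length (q # ts) = Suc n - (n - k)"
      using distinct_card[OF that(4)] that(5) by simp
    then have l: "length ts = k" using k by simp
    have "card ({..n} - {m}) = n" using that(1,3) by (subst card_Diff_subset) auto
    then have l': "length ts' = n - 1" using distinct_card[OF that(6)] that(7) by simp
    have q: "q \<in> {..n} - (\<tau> - {m})" and q': "q' \<in> {..n} - {m}"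
      using that(5,7) by (metis list.set_intros(1))+
    have t: "set ts = {..n} - (\<tau> - {m}) - {q}" using that(4) that(5)[symmetric] by auto
    have t': "set ts' = {..n} - {m} - {q'}" using that(6) that(7)[symmetric] by auto
    have "biform_inner k (n - 1) \<omega>
        (tensor (hodge_star (card (\<tau> - {m})) (dlam lam (\<tau> - {m}))) (hodge_star (card {m}) (dlam lam {m}))) = 0
      \<longleftrightarrow> \<omega> (map (edge q) ts) (map (edge q') ts') = 0"
      by (rule biform_inner_star_dlam[OF _ _ _ _ t _ _ _ _ t' l l' \<omega>2]) (use that q q' in auto)
    then show ?thesis using cR by simp
  qed

  \<comment> \<open>The relation \<open>s \<omega> = 0\<close>, evaluated on the edges issuing from a vertex outside \<open>\<tau>\<close>, expresses the
    pairing at the minimum of \<open>\<tau>\<close> through those at the other elements.\<close>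
  have all: "?p \<tau> m = 0" if \<tau>: "\<tau> \<subseteq> {..n}" "card \<tau> = n - k + 1" and m: "m \<in> \<tau>" for \<tau> m
  proof (cases "m = Min \<tau>")
    case True
    have fin: "finite \<tau>" using \<tau>(1) finite_subset by blast
    have "card ({..n} - \<tau>) = k" using \<tau> fin k by (simp add: card_Diff_subset)
    then have "{..n} - \<tau> \<noteq> {}" using k by (metis card.empty not_one_le_zero)
    then obtain q where q: "q \<le> n" "q \<notin> \<tau>" by auto
    define gs where "gs = sorted_list_of_set ({..n} - \<tau> - {q})"
    define xs where "xs = sorted_list_of_set ({..n} - {q})"
    have gs: "distinct gs" "set gs = {..n} - \<tau> - {q}" by (auto simp: gs_def)
    have xs: "distinct xs" "set xs = {..n} - {q}" by (auto simp: xs_def)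
    let ?vs = "map (edge q) xs" and ?ws = "map (edge q) gs"
    let ?t = "\<lambda>i. (- 1) ^ i * \<omega> (?vs ! i # ?ws) (take i ?vs @ drop (Suc i) ?vs)"
    have del: "distinct (take i xs @ drop (Suc i) xs)"
      "set (take i xs @ drop (Suc i) xs) = {..n} - {q} - {xs ! i}" if "i < length xs" for i
    proof -
      have "distinct (take i xs @ xs ! i # drop (Suc i) xs)"
        "set (take i xs @ xs ! i # drop (Suc i) xs) = {..n} - {q}"
        using xs id_take_nth_drop[OF that] by simp_all
      then show "distinct (take i xs @ drop (Suc i) xs)"
        "set (take i xs @ drop (Suc i) xs) = {..n} - {q} - {xs ! i}" by auto
    qed
    have t: "?t i = (- 1) ^ i * \<omega> (map (edge q) (xs ! i # gs)) (map (edge q) (take i xs @ drop (Suc i) xs))"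
      if "i < length xs" for i using that by (simp add: take_map drop_map)
    have in_xs: "xs ! i \<le> n" "xs ! i \<noteq> q" if "i < length xs" for i
      using nth_mem[OF that] unfolding xs(2) by auto
    have pt: "?p \<tau> (xs ! i) = 0 \<longleftrightarrow> ?t i = 0" if "i < length xs" "xs ! i \<in> \<tau>" for i
    proof -
      have "?p \<tau> (xs ! i) = 0 \<longleftrightarrow>
          \<omega> (map (edge q) (xs ! i # gs)) (map (edge q) (take i xs @ drop (Suc i) xs)) = 0"
        by (rule pair[OF \<tau> that(2)]) (use del[OF that(1)] gs q that in_xs[OF that(1)] in auto)
      then show ?thesis unfolding t[OF that(1)] by simp
    qed
    obtain l where l: "l < length xs" "xs ! l = m"
      using m q \<tau> xs(2) by (metis Diff_iff in_set_conv_nth singletonD subsetD)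
    \<comment> \<open>For a vertex in \<tau> the assumption applies, since it is not the minimum.
      Any other vertex already occurs in \<open>gs\<close>, and its edge is repeated in the left
      slot.\<close>
    have "?t i = 0" if i: "i \<in> {..<length xs} - {l}" for i
    proof (cases "xs ! i \<in> \<tau>")
      case True
      have "xs ! i \<noteq> m" using i l xs(1) by (auto simp: nth_eq_iff_index_eq)
      then show ?thesis using pt[OF _ True] 0[OF \<tau> True] i \<open>m = Min \<tau>\<close> by auto
    next
      case False
      then have "xs ! i \<in> set gs" using in_xs[of i] i gs(2) by auto
      then have "\<not> distinct (map (edge q) (xs ! i # gs))" by auto
      then have "\<omega> (map (edge q) (xs ! i # gs)) vs = 0" for vs
        by (rule Alt_not_distinct[OF Alt2_slices(1)[OF \<omega>2]])
      then show ?thesis using t[of i] i by simp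
    qed
    then have "s_map \<omega> ?ws ?vs = ?t l"
      using l(1) sum.remove[of "{..<length xs}" l ?t] by (simp add: s_map_def)
    then have "?t l = 0" using s by simp
    then show ?thesis using pt[OF l(1)] l(2) m by simp
  qed (use 0 \<tau> m in blast)

  \<comment> \<open>The same vanishing, indexed by the face with vertices \<open>q # ts\<close>: the
    set \<tau> consists of \<open>m\<close> and all vertices off the face.\<close>
  have face: "\<omega> (map (edge q) ts) (map (edge q') ts') = 0"
    if "distinct (q # ts)" "set (q # ts) \<subseteq> {..n}" "length ts = k" "m \<in> set (q # ts)"
      "distinct (q' # ts')" "set (q' # ts') = {..n} - {m}" for q ts q' ts' m
  proof -
    define \<tau> where "\<tau> = insert m ({..n} - set (q # ts))"
    have "m \<le> n" using that(2,4) by auto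
    then have \<tau>: "\<tau> \<subseteq> {..n}" "m \<in> \<tau>" by (auto simp: \<tau>_def)
    have "card ({..n} - set (q # ts)) = n - k"
      using that(2,3) distinct_card[OF that(1)] by (subst card_Diff_subset) auto
    then have c: "card \<tau> = n - k + 1" using that(4) by (simp add: \<tau>_def)
    have "set (q # ts) = {..n} - (\<tau> - {m})" using that(2,4) by (auto simp: \<tau>_def)
    then show ?thesis using pair[OF \<tau>(1) c \<tau>(2) that(1) _ that(5,6)] all[OF \<tau>(1) c \<tau>(2)] by simp
  qed

  let ?B = "edge 0 ` ({..n} - {0})"
  have lists: "\<exists>xs. vs = map (edge 0) xs \<and> set xs \<subseteq> {..n} - {0}" if "set vs \<subseteq> ?B" for vs
  proof -
    have "vs \<in> lists ?B" using that by auto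
    then show ?thesis unfolding lists_image by auto
  qed
  have "(\<lambda>ws. \<omega> ws (map (edge 0) ms)) = 0"
    if ms: "distinct ms" "set ms \<subseteq> {..n} - {0}" "length ms = n - 1" for ms
  proof -
    define f where "f ws = \<omega> ws (map (edge 0) ms)" for ws
    have f: "f \<in> Alt k" unfolding f_def using Alt2_slices(1)[OF \<omega>2] .
    \<comment> \<open>Only one of the \<open>n\<close> edges at vertex 0 is left out; the others
      span the facet opposite to its end \<open>m\<close>.\<close>
    have "card ({..n} - {0} - set ms) = 1"
      using ms distinct_card[OF ms(1)] n2 by (subst card_Diff_subset) auto
    then obtain m where m: "{..n} - {0} - set ms = {m}" by (auto simp: card_1_singleton_iff)
    then have m': "m \<le> n" "m \<noteq> 0" and ms0: "distinct (0 # ms)" "set (0 # ms) = {..n} - {m}"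
      using ms by auto
    have f0: "f vs = 0" if "edge 0 m \<in> set vs" for vs
    proof (rule Alt_eq_0_if_mem[OF f span_edges[of 0] that])
      show "edge 0 m \<in> ?B" using m' by auto
      fix vs assume vs: "set vs \<subseteq> ?B" "distinct vs" "length vs = k" "edge 0 m \<in> set vs"
      obtain xs where xs: "vs = map (edge 0) xs" "set xs \<subseteq> {..n} - {0}" using lists[OF vs(1)] by blast
      have "m \<in> set xs"
      proof -
        obtain x where x: "x \<in> set xs" "edge 0 m = edge 0 x" using vs(4) xs(1) by auto
        moreover have "x \<le> n" using x(1) xs(2) by auto
        ultimately have "m = x" using inj_onD[OF inj_edge[of 0], of m x] m' by simp
        then show ?thesis using x by simp
      qed
      moreover have "0 \<notin> set xs" "set xs \<subseteq> {..n}" using xs(2) by auto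
      ultimately show "f vs = 0"
        using face[of 0 xs m 0 ms] ms0 vs xs by (auto simp: f_def distinct_map)
    qed
    have "f = 0"
    proof (rule Alt_eq_0_on_span[OF f span_edges[of 0]])
      fix vs assume vs: "set vs \<subseteq> ?B" "distinct vs" "length vs = k"
      obtain xs where xs: "vs = map (edge 0) xs" "set xs \<subseteq> {..n} - {0}" using lists[OF vs(1)] by blast
      show "f vs = 0"
      proof (cases "m \<in> set xs")
        case True
        then show ?thesis using f0 xs(1) by auto
      next
        case False
        have "set xs \<subseteq> {..n}" using xs(2) by auto
        \<comment> \<open>The face on \<open>m\<close> and \<open>xs\<close> is used with base
          vertex \<open>m\<close>. Its edges are edges at 0 minus \<open>edge 0 m\<close>, and
          \<open>f0\<close> discards the subtracted vector.\<close>
        then have "f (map (edge m) xs) = 0"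
          using face[of m xs m 0 ms] False ms0 vs xs m' by (auto simp: f_def distinct_map)
        moreover have "map (edge m) xs = map (\<lambda>x. x - edge 0 m) vs" using xs by simp
        ultimately show ?thesis using Alt_map_diff[OF f f0] by simp
      qed
    qed
    then show ?thesis by (simp add: f_def[abs_def])
  qed
  then have z: "\<omega> ws (map (edge 0) ms) = 0"
    if "distinct ms" "set ms \<subseteq> {..n} - {0}" "length ms = n - 1" for ms ws
    using that by (simp add: fun_eq_iff)
  have "\<omega> ws = 0" for ws
  proof (rule Alt_eq_0_on_span[OF Alt2_slices(2)[OF \<omega>2] span_edges[of 0]])
    fix vs assume vs: "set vs \<subseteq> ?B" "distinct vs" "length vs = n - 1"
    obtain xs where xs: "vs = map (edge 0) xs" "set xs \<subseteq> {..n} - {0}" using lists[OF vs(1)] by blast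
    then show "\<omega> ws vs = 0" using z[of xs ws] vs by (auto simp: distinct_map)
  qed
  then show ?thesis by (simp add: fun_eq_iff)
qed

end

section \<open>Biorthogonal families and projections\<close>

text \<open>The functional \<open>b i\<close> vanishes on the span of the other vectors but not at
  \<open>x i\<close>.\<close>

lemma biorthogonal_independent:
  fixes b :: "'i \<Rightarrow> 'a::real_vector \<Rightarrow> real"
  assumes lin: "\<And>i. i \<in> I \<Longrightarrow> linear (b i)"
    and nz: "\<And>i j. i \<in> I \<Longrightarrow> j \<in> I \<Longrightarrow> b j (x i) \<noteq> 0 \<longleftrightarrow> i = j"
  shows "inj_on x I" and "independent (x ` I)"
proof -
  show "inj_on x I" using nz by (intro inj_onI) metis
  show "independent (x ` I)"
    unfolding dependent_def
  proof (rule notI, elim bexE)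
    fix v assume "v \<in> x ` I" and span: "v \<in> span (x ` I - {v})"
    then obtain i where i: "i \<in> I" "v = x i" by auto
    have "b i v = 0"
      by (rule linear_eq_0_on_span[OF lin[OF i(1)] _ span]) (use nz i in auto)
    then show False using nz[OF i(1) i(1)] i by simp
  qed
qed

text \<open>The expansion \<open>w\<close> with coefficients \<open>b i v / b i (x i)\<close> agrees
  with \<open>v\<close> under all functionals, and these separate the points of
  \<open>V\<close>.\<close>

lemma biorthogonal_basis:
  fixes b :: "'i \<Rightarrow> 'a::real_vector \<Rightarrow> real"
  assumes V: "subspace V" and fin: "finite I" and x: "x ` I \<subseteq> V"
    and lin: "\<And>i. i \<in> I \<Longrightarrow> linear (b i)"
    and nz: "\<And>i j. i \<in> I \<Longrightarrow> j \<in> I \<Longrightarrow> b j (x i) \<noteq> 0 \<longleftrightarrow> i = j"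
    and 0: "\<And>v. v \<in> V \<Longrightarrow> (\<And>i. i \<in> I \<Longrightarrow> b i v = 0) \<Longrightarrow> v = 0"
  shows "is_basis_of (x ` I) V"
proof -
  have "v \<in> span (x ` I)" if v: "v \<in> V" for v
  proof -
    define w where "w = (\<Sum>i\<in>I. (b i v / b i (x i)) *\<^sub>R x i)"
    have w: "w \<in> span (x ` I)" unfolding w_def by (intro span_sum span_scale span_base) auto
    have "v - w = 0"
    proof (rule 0)
      have "w \<in> V" using w x V span_minimal by blast
      then show "v - w \<in> V" using v V by (simp add: subspace_diff)
      fix j assume j: "j \<in> I"
      have "b j w = (\<Sum>i\<in>I. (b i v / b i (x i)) * b j (x i))"
        using lin[OF j] by (simp add: w_def linear_sum linear_scale)
      also have "\<dots> = (\<Sum>i\<in>I. if i = j then b j v else 0)"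
        using nz j by (intro sum.cong) auto
      also have "\<dots> = b j v" using fin j by simp
      finally show "b j (v - w) = 0" using lin[OF j] by (simp add: linear_diff)
    qed
    then show ?thesis using w by simp
  qed
  moreover have "span (x ` I) \<subseteq> V" using x V span_minimal by blast
  ultimately show ?thesis
    using biorthogonal_independent(2)[OF lin nz] by (auto simp: is_basis_of_def)
qed

text \<open>A vector of \<open>V\<close> outside \<open>span C\<close> would extend \<open>C\<close>
  to an independent set larger than the spanning set \<open>B\<close>. This turns independence of
  the projected family into a basis.\<close>

lemma independent_same_card_basis:
  fixes B C :: "'a::real_vector set"
  assumes B: "is_basis_of B V" and fin: "finite B"
    and C: "independent C" "C \<subseteq> V" "card C = card B"
  shows "is_basis_of C V"
proof -
  have spB: "span B = V" using B by (simp add: is_basis_of_def)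
  have finC: "finite C" using independent_span_bound[OF fin C(1)] C(2) spB by auto
  have "V \<subseteq> span C"
  proof
    fix v assume v: "v \<in> V"
    show "v \<in> span C"
    proof (rule ccontr)
      assume nv: "v \<notin> span C"
      then have "independent (insert v C)" "v \<notin> C" using C(1) by (auto simp: independent_insert span_base)
      then have "card (insert v C) \<le> card B"
        using independent_span_bound[OF fin] v C(2) spB by auto
      then show False using \<open>v \<notin> C\<close> finC C(3) by simp
    qed
  qed
  moreover have "span C \<subseteq> V" using span_mono[OF C(2)] spB by (metis span_span)
  ultimately show ?thesis using C(1) by (auto simp: is_basis_of_def)
qed

section \<open>Orthogonal projection onto the kernel\<close>

text \<open>Gram-Schmidt by induction on \<open>B\<close>. Definiteness is assumed on the span only,
  because on arbitrary functions \<open>biform_inner\<close> sees nothing but the values at unit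
  vectors.\<close>

lemma orthogonal_projection_exists:
  fixes b :: "'a::real_vector \<Rightarrow> 'a \<Rightarrow> real"
  assumes "finite B"
    and l: "\<And>w. linear (\<lambda>v. b v w)" and sym: "\<And>v w. b v w = b w v"
    and pd: "\<And>v. v \<in> span B \<Longrightarrow> b v v = 0 \<Longrightarrow> v = 0"
  shows "\<exists>\<eta>\<in>span B. \<forall>\<xi>\<in>span B. b (\<omega> - \<eta>) \<xi> = 0"
  using assms(1) pd
proof (induction B arbitrary: \<omega> rule: finite_induct)
  case empty
  have "b \<omega> 0 = 0" using linear_0[OF l, of \<omega>] sym by metis
  then show ?case by simp
next
  case (insert x B)
  have r: "linear (b w)" for w
  proof -
    have "b w = (\<lambda>v. b v w)" using sym by auto
    then show ?thesis using l by metis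
  qed
  have sub: "span B \<subseteq> span (insert x B)" by (intro span_mono) auto

  have IH: "\<exists>\<eta>\<in>span B. \<forall>\<xi>\<in>span B. b (\<omega> - \<eta>) \<xi> = 0" for \<omega>
    by (rule insert.IH) (use insert.prems sub in auto)
  obtain p where p: "p \<in> span B" "\<forall>\<xi>\<in>span B. b (x - p) \<xi> = 0" using IH by blast
  obtain \<eta> where \<eta>: "\<eta> \<in> span B" "\<forall>\<xi>\<in>span B. b (\<omega> - \<eta>) \<xi> = 0" using IH by blast
  \<comment> \<open>The part of the new vector orthogonal to \<open>span B\<close>. If it is zero
    the span does not grow; otherwise the old projection is corrected along
    \<open>y\<close>.\<close>
  define y where "y = x - p"
  have y: "y \<in> span (insert x B)" unfolding y_def
    by (rule span_diff[OF span_base]) (use p(1) sub in auto)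
  have yB: "b y \<xi> = 0" if "\<xi> \<in> span B" for \<xi> using p(2) that by (simp add: y_def)
  show ?case
  proof (cases "y = 0")
    case True
    then have "x \<in> span B" using p(1) by (simp add: y_def)
    then have "span (insert x B) = span B" by (simp add: span_redundant)
    then show ?thesis using \<eta> by auto
  next
    case False
    then have yy: "b y y \<noteq> 0" using insert.prems y by blast
    define \<eta>' where "\<eta>' = \<eta> + (b \<omega> y / b y y) *\<^sub>R y"
    have "\<eta>' \<in> span (insert x B)" unfolding \<eta>'_def
      using \<eta>(1) sub y by (intro span_add span_scale) auto
    moreover have "b (\<omega> - \<eta>') \<xi> = 0" if \<xi>: "\<xi> \<in> span (insert x B)" for \<xi>
    proof -
      obtain c where c: "\<xi> - c *\<^sub>R x \<in> span B" using \<xi> by (auto simp: span_breakdown_eq)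
      define z where "z = \<xi> - c *\<^sub>R x + c *\<^sub>R p"
      have z: "z \<in> span B" unfolding z_def using c p(1) by (intro span_add span_scale) auto
      have \<xi>_eq: "\<xi> = c *\<^sub>R y + z" by (simp add: z_def y_def algebra_simps)
      have L: "b (\<omega> - \<eta>') w = b (\<omega> - \<eta>) w - (b \<omega> y / b y y) * b y w" for w
        by (simp add: \<eta>'_def linear_diff[OF l] linear_add[OF l] linear_scale[OF l])
      have "b (\<omega> - \<eta>') z = 0" using L \<eta>(2) z yB by simp
      moreover have "b (\<omega> - \<eta>') y = 0"
        unfolding L using yy yB[OF \<eta>(1)] sym[of \<eta> y] by (simp add: linear_diff[OF l])
      ultimately show ?thesis by (simp add: \<xi>_eq linear_add[OF r] linear_scale[OF r])
    qed
    ultimately show ?thesis by blast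
  qed
qed

lemma biform_inner_commute: "biform_inner j m \<omega> \<eta> = biform_inner j m \<eta> \<omega>"
  by (simp add: biform_inner_def mult.commute)

lemma linear_biform_inner: "linear (\<lambda>\<omega>. biform_inner j m \<omega> \<eta>)"
  by (auto simp: linear_iff biform_inner_def scaleR_fun_def sum.distrib sum_distrib_left algebra_simps)

text \<open>A vanishing sum of squares kills all values on increasing unit vectors; alternation and
  linearity extend this to the left slot, then to the right one.\<close>

lemma biform_inner_definite:
  fixes \<omega> :: "(real^'n::{finite,linorder}) biform"
  assumes \<omega>: "\<omega> \<in> Alt2 j m" and 0: "biform_inner j m \<omega> \<omega> = 0"
  shows "\<omega> = 0"
proof -
  have u: "\<omega> (units is) (units ls) = 0"
    if "is \<in> increasing_seqs j" "ls \<in> increasing_seqs m" for "is" ls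
    using 0 that unfolding biform_inner_def
    by (simp add: sum_nonneg_eq_0_iff finite_increasing_seqs sum_nonneg)
  have "(\<lambda>ws. \<omega> ws (units ls)) = 0" if "ls \<in> increasing_seqs m" for ls
    by (rule Alt_eq_0_increasing[OF Alt2_slices(1)[OF \<omega>]]) (use u that in auto)
  then have "\<omega> ws (units ls) = 0" if "ls \<in> increasing_seqs m" for ws ls
    using that by (simp add: fun_eq_iff)
  then have "\<omega> ws = 0" for ws
    by (intro Alt_eq_0_increasing[OF Alt2_slices(2)[OF \<omega>]]) auto
  then show ?thesis by (simp add: fun_eq_iff)
qed

lemma subspace_XX: "subspace (XX k :: (real^'n::finite) biform set)"
proof -
  have 1: "s_map (0 :: (real^'n) biform) = 0" by (simp add: s_map_def fun_eq_iff)
  have 2: "s_map (\<omega> + \<eta>) = s_map \<omega> + s_map \<eta>" for \<omega> \<eta> :: "(real^'n) biform"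
    by (simp add: s_map_def fun_eq_iff sum.distrib algebra_simps)
  have 3: "s_map (c *\<^sub>R \<omega>) = c *\<^sub>R s_map \<omega>" for c and \<omega> :: "(real^'n) biform"
    by (simp add: s_map_def fun_eq_iff scaleR_fun_def sum_distrib_left mult_ac)
  have "subspace (Alt2 j m :: (real^'n) biform set)" for j m by (simp add: Alt2_def)
  then show ?thesis
    unfolding XX_def by (auto simp: subspace_def 1 2 3)
qed

text \<open>Existence comes from the finite spanning set and uniqueness from definiteness, which
  settles the definite description. The second claim lets pairings with kernel elements ignore the
  projection.\<close>

lemma proj_XX:
  fixes \<omega> :: "(real^'n::{finite,linorder}) biform" and B :: "(real^'n::_) biform set"
  assumes "finite B" "span B = XX k"
  shows "proj_XX k \<omega> \<in> XX k"
    and "\<xi> \<in> XX k \<Longrightarrow> biform_inner k (CARD('n) - 1) \<xi> (proj_XX k \<omega>) = biform_inner k (CARD('n) - 1) \<xi> \<omega>"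
proof -
  let ?b = "biform_inner k (CARD('n) - 1) :: (real^'n::_) biform \<Rightarrow> _"
  have pd: "v = 0" if "v \<in> XX k" "?b v v = 0" for v
    using that biform_inner_definite by (auto simp: XX_def)
  obtain \<eta> where \<eta>: "\<eta> \<in> XX k" "\<forall>\<xi>\<in>XX k. ?b (\<omega> - \<eta>) \<xi> = 0"
    using orthogonal_projection_exists[OF assms(1), of ?b \<omega>]
      linear_biform_inner biform_inner_commute pd unfolding assms(2) by metis
  have "proj_XX k \<omega> = \<eta>"
    unfolding proj_XX_def
  proof (rule the_equality)
    fix \<eta>' assume \<eta>': "\<eta>' \<in> XX k \<and> (\<forall>\<xi>\<in>XX k. ?b (\<omega> - \<eta>') \<xi> = 0)"
    have d: "\<eta> - \<eta>' \<in> XX k" using \<eta> \<eta>' by (intro subspace_diff subspace_XX) auto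
    have "?b (\<eta> - \<eta>') (\<eta> - \<eta>') = ?b ((\<omega> - \<eta>') - (\<omega> - \<eta>)) (\<eta> - \<eta>')" by simp
    also have "\<dots> = ?b (\<omega> - \<eta>') (\<eta> - \<eta>') - ?b (\<omega> - \<eta>) (\<eta> - \<eta>')"
      by (rule linear_diff[OF linear_biform_inner])
    finally show "\<eta>' = \<eta>" using pd[OF d] d \<eta> \<eta>' by simp
  qed (use \<eta> in blast)
  then show "proj_XX k \<omega> \<in> XX k"
    and "\<xi> \<in> XX k \<Longrightarrow> ?b \<xi> (proj_XX k \<omega>) = ?b \<xi> \<omega>"
    using \<eta> linear_diff[OF linear_biform_inner, of k "CARD('n) - 1" \<omega> \<eta> \<xi>]
    by (auto simp: biform_inner_commute[of _ _ \<xi>])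
qed

section \<open>From the simplex to the differentials of its barycentric coordinates\<close>

text \<open>Affine independence of the vertices makes coefficients unique. Applied to suitable
  combinations of the coordinates, this shows that each is affine and takes the Kronecker values at
  the vertices.\<close>

lemma barycentric_simplex:
  fixes a :: "nat \<Rightarrow> real^'n::{finite,linorder}"
  assumes n: "n = CARD('n)" and T: "(int n) simplex T"
    and a: "bij_betw a {0..n} {v. v extreme_point_of T}" and lam: "barycentric_coords a lam"
  shows "barycentric a lam n"
proof -
  obtain C where C: "\<not> affine_dependent C" "T = convex hull C" using T by (auto simp: simplex)
  then have "{v. v extreme_point_of T} = C"
    by (simp add: extreme_point_of_convex_hull_affine_independent)
  then have aC: "bij_betw a {..n} C" using a by (simp add: atLeast0AtMost)
  have finC: "finite C" using aC bij_betw_finite by blast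
  have uniq: "c j = 0" if c: "(\<Sum>j\<le>n. c j) = 0" "(\<Sum>j\<le>n. c j *\<^sub>R a j) = 0" and j: "j \<le> n" for c j
  proof (rule ccontr)
    assume nz: "c j \<noteq> 0"
    \<comment> \<open>Affine dependence speaks of coefficients on the vertex set, so
      \<open>c\<close> is transported along the bijection \<open>a\<close>.\<close>
    define U where "U = c \<circ> the_inv_into {..n} a"
    have U: "U (a j) = c j" if "j \<in> {..n}" for j
      using aC that by (simp add: U_def the_inv_into_f_f bij_betw_def)
    have "sum U C = (\<Sum>j\<le>n. U (a j))" "(\<Sum>v\<in>C. U v *\<^sub>R v) = (\<Sum>j\<le>n. U (a j) *\<^sub>R a j)"
      by (simp_all only: sum.reindex_bij_betw[OF aC, of U] sum.reindex_bij_betw[OF aC, of "\<lambda>v. U v *\<^sub>R v"])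
    then have "sum U C = 0" "(\<Sum>v\<in>C. U v *\<^sub>R v) = 0" using U c by simp_all
    moreover have "a j \<in> C" "U (a j) \<noteq> 0" using aC j nz U by (auto simp: bij_betw_def)
    ultimately have "affine_dependent C" using affine_dependent_explicit_finite[OF finC] by blast
    then show False using C(1) by simp
  qed
  have lam: "(\<Sum>j\<le>n. lam j x) = 1" "(\<Sum>j\<le>n. lam j x *\<^sub>R a j) = x" for x
    using lam by (auto simp: barycentric_coords_def n)
  define L where "L j v = lam j v - lam j 0" for j v
  have linL: "linear (L j)" if j: "j \<le> n" for j
  proof (rule linearI)
    fix x y
    \<comment> \<open>These coefficients add up to 1 - 1 - 1 + 1, and weight the vertices to
      \<open>(x + y) - x - y + 0\<close>.\<close>
    have "lam j (x + y) - lam j x - lam j y + lam j 0 = 0"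
      by (rule uniq[OF _ _ j]) (simp_all add: sum.distrib sum_subtractf lam algebra_simps)
    then show "L j (x + y) = L j x + L j y" by (simp add: L_def)
  next
    fix r x
    have "lam j (r *\<^sub>R x) - r * lam j x - (1 - r) * lam j 0 = 0"
    proof (rule uniq[OF _ _ j])
      show "(\<Sum>j\<le>n. lam j (r *\<^sub>R x) - r * lam j x - (1 - r) * lam j 0) = 0"
        by (simp add: sum_subtractf lam flip: sum_distrib_left)
      show "(\<Sum>j\<le>n. (lam j (r *\<^sub>R x) - r * lam j x - (1 - r) * lam j 0) *\<^sub>R a j) = 0"
        by (simp add: scaleR_diff_left sum_subtractf lam flip: scaleR_scaleR scaleR_sum_right)
    qed
    then show "L j (r *\<^sub>R x) = r *\<^sub>R L j x" by (simp add: L_def algebra_simps)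
  qed
  have D: "frechet_derivative (lam j) (at 0) = L j" if j: "j \<le> n" for j
  proof -
    have "(L j has_derivative L j) (at 0)"
      using linL[OF j] by (simp add: linear_conv_bounded_linear bounded_linear_imp_has_derivative)
    then have "((\<lambda>v. L j v + lam j 0) has_derivative L j) (at 0)"
      by (auto intro!: derivative_eq_intros)
    then show ?thesis using frechet_derivative_at[of "lam j" "L j" 0] by (simp add: L_def)
  qed
  have vertex: "lam j (a x) = of_bool (j = x)" if "j \<le> n" "x \<le> n" for j x
  proof -
    have "lam j (a x) - of_bool (j = x) = 0"
      by (rule uniq[OF _ _ that(1)])
        (use that(2) in \<open>simp_all add: sum_subtractf scaleR_diff_left lam of_bool_def if_distrib[of "\<lambda>c. c *\<^sub>R _"] cong: if_cong\<close>)
    then show ?thesis by simp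
  qed
  show ?thesis
  proof (rule barycentric.intro)
    show "n = CARD('n)" by (rule n)
    fix j assume j: "j \<le> n"
    show "linear (frechet_derivative (lam j) (at 0))" using D linL j by simp
    fix x y assume "x \<le> n" "y \<le> n"
    then show "frechet_derivative (lam j) (at 0) (a x - a y) = of_bool (j = x) - of_bool (j = y)"
      unfolding D[OF j] linear_diff[OF linL[OF j]] using j by (simp add: L_def vertex)
  next
    fix v
    show "(\<Sum>j\<le>n. frechet_derivative (lam j) (at 0) v) = 0"
      using D by (simp add: L_def sum_subtractf lam)
    show "(\<Sum>j\<le>n. frechet_derivative (lam j) (at 0) v *\<^sub>R a j) = v"
      using D by (simp add: L_def sum_subtractf lam scaleR_diff_left)
  qed
qed

section \<open>Increasing maps and their ranges\<close>

lemma Sig_range: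
  assumes "\<sigma> \<in> Sig r n"
  shows "inj_on \<sigma> {0..r}" and "\<sigma> ` {0..r} \<subseteq> {..n}" and "card (\<sigma> ` {0..r}) = r + 1"
proof -
  show "inj_on \<sigma> {0..r}" using assms strict_mono_on_imp_inj_on by (auto simp: Sig_def)
  then show "card (\<sigma> ` {0..r}) = r + 1" by (simp add: card_image)
  show "\<sigma> ` {0..r} \<subseteq> {..n}" using assms by (auto simp: Sig_def)
qed

text \<open>The values of either map, in order, are the strictly sorted list of the common range;
  extensionality settles the arguments beyond \<open>r\<close>.\<close>

lemma Sig_eqI:
  assumes \<sigma>: "\<sigma> \<in> Sig r n" and \<tau>: "\<tau> \<in> Sig r n" and eq: "\<sigma> ` {0..r} = \<tau> ` {0..r}"
  shows "\<sigma> = \<tau>"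
proof -
  have *: "sorted_wrt (<) (map \<upsilon> [0..<Suc r])" if "\<upsilon> \<in> Sig r n" for \<upsilon>
    using that by (auto simp: Sig_def sorted_wrt_iff_nth_less strict_mono_on_def simp del: upt_Suc)
  have "map \<sigma> [0..<Suc r] = map \<tau> [0..<Suc r]"
    using eq by (intro strict_sorted_equal * \<sigma> \<tau>)
      (simp del: upt_Suc add: atLeastLessThanSuc_atLeastAtMost)
  then have "\<forall>x\<in>set [0..<Suc r]. \<sigma> x = \<tau> x" unfolding map_eq_conv .
  then have "\<sigma> x = \<tau> x" if "x \<in> {0..r}" for x
    using that unfolding set_upt atLeastLessThanSuc_atLeastAtMost by blast
  moreover have "\<sigma> \<in> {0..r} \<rightarrow>\<^sub>E {0..n}" "\<tau> \<in> {0..r} \<rightarrow>\<^sub>E {0..n}"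
    using \<sigma> \<tau> unfolding Sig_def by blast+
  ultimately show ?thesis by (intro PiE_ext)
qed

text \<open>Here \<sigma> reads off the sorted list of \<tau>. Its entry at 0 is the minimum, so
  \<open>m\<close> sits at a positive index.\<close>

lemma Sig_obtain:
  assumes \<tau>: "\<tau> \<subseteq> {..n}" "card \<tau> = r + 1" and m: "m \<in> \<tau>" "m \<noteq> Min \<tau>"
  obtains \<sigma> i where "\<sigma> \<in> Sig r n" "i \<in> {1..r}" "\<sigma> ` {0..r} = \<tau>" "\<sigma> i = m"
proof -
  have fin: "finite \<tau>" using \<tau>(1) finite_subset by blast
  define xs where "xs = sorted_list_of_set \<tau>"
  have xs: "sorted_wrt (<) xs" "set xs = \<tau>" "length xs = Suc r" using fin \<tau> by (auto simp: xs_def)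
  define \<sigma> where "\<sigma> = restrict (\<lambda>i. xs ! i) {0..r}"
  have "\<sigma> ` {0..r} = (!) xs ` {0..<length xs}"
    using xs(3) by (intro image_cong) (auto simp: \<sigma>_def)
  also have "\<dots> = \<tau>" using xs(2) by (auto simp: set_conv_nth)
  finally have im: "\<sigma> ` {0..r} = \<tau>" .
  have less: "xs ! i < xs ! l" if "i < l" "l \<le> r" for i l
    using sorted_wrt_nth_less[OF xs(1)] that xs(3) by simp
  have "xs ! i \<le> n" if "i \<le> r" for i using nth_mem[of i xs] xs(2,3) \<tau>(1) that by auto
  then have "\<sigma> \<in> Sig r n"
    by (auto simp: Sig_def \<sigma>_def strict_mono_on_def intro: less)
  moreover obtain i where i: "i \<in> {0..r}" "\<sigma> i = m" using m(1) im by blast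
  moreover have "i \<noteq> 0"
  proof
    assume "i = 0"
    then have "m = xs ! 0" using i by (simp add: \<sigma>_def)
    moreover have "xs ! 0 \<le> x" if x: "x \<in> \<tau>" for x
    proof -
      obtain l where "l < length xs" "x = xs ! l" using x xs(2) by (metis in_set_conv_nth)
      then show ?thesis using less[of 0 l] xs(3) by (cases "l = 0") auto
    qed
    ultimately have "m = Min \<tau>" using m(1) fin by (intro Min_eqI[symmetric]) auto
    then show False using m(2) by simp
  qed
  ultimately show thesis using that[of \<sigma> i] im by auto
qed

theorem theorem5p7:
  fixes T :: "(real^('n::{finite,linorder})) set"
    and a :: "nat \<Rightarrow> real^'n::_" and lam :: "nat \<Rightarrow> real^'n::_ \<Rightarrow> real" and n k :: nat
  assumes "n = CARD('n)" and "n \<ge> 2" and "1 \<le> k" and "k \<le> n - 1"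
    and "(int n) simplex T" and "bij_betw a {0..n} {v. v extreme_point_of T}"
    and "barycentric_coords a lam"
  shows "is_basis_of {phi k lam \<sigma> i | \<sigma> i. \<sigma> \<in> Sig (n - k) n \<and> i \<in> {1..n - k}} (XX k)
    \<and> is_basis_of {psi k lam \<sigma> i | \<sigma> i. \<sigma> \<in> Sig (n - k) n \<and> i \<in> {1..n - k}} (XX k)
    \<and> (\<forall>\<sigma>\<in>Sig (n - k) n. \<forall>\<tau>\<in>Sig (n - k) n. \<forall>i\<in>{1..n - k}. \<forall>j\<in>{1..n - k}.
         biform_inner k (n - 1) (phi k lam \<sigma> i) (psi k lam \<tau> j) \<noteq> 0 \<longleftrightarrow> \<sigma> = \<tau> \<and> i = j)"
proof -
  interpret barycentric a lam "\<lambda>j. frechet_derivative (lam j) (at 0)" n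
    using barycentric_simplex[OF assms(1,5-7)] .
  let ?b = "biform_inner k (n - 1) :: (real^'n::_) biform \<Rightarrow> _"
  define r where "r = n - k"
  have r: "k + r = n" "n - k = r" using assms by (auto simp: r_def)
  define I where "I = Sig r n \<times> {1..r}"
  define x where "x = (\<lambda>(\<sigma>, i). phi k lam \<sigma> i)"
  \<comment> \<open>The second family before projection. Pairing and separation are proved for
    \<open>y\<close>; the pairing then passes to \<open>z\<close> by \<open>proj_XX\<close>.\<close>
  define y where "y = (\<lambda>(\<sigma>, i). tensor (hodge_star r (dlam lam (\<sigma> ` {0..r} - {\<sigma> i})))
    (hodge_star 1 (dlam lam {\<sigma> i})))"
  define z where "z = (\<lambda>(\<sigma>, i). psi k lam \<sigma> i)"
  have x_eq: "x (\<sigma>, i) = tensor (dlam lam ({..n} - \<sigma> ` {0..r})) (dlam lam ({..n} - {\<sigma> 0, \<sigma> i}))" for \<sigma> i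
    by (simp add: x_def phi_def r flip: assms(1) atLeast0AtMost)
  have z_eq: "z p = proj_XX k (y p)" for p
    by (simp add: z_def y_def psi_def r split: prod.split flip: assms(1))
  have finI: "finite I"
  proof -
    have "Sig r n \<subseteq> {0..r} \<rightarrow>\<^sub>E {0..n}" unfolding Sig_def by blast
    then have "finite (Sig r n)" by (rule finite_subset) (simp add: finite_PiE)
    then show ?thesis by (simp add: I_def)
  qed
  have Sig: "\<sigma> 0 \<le> n" "\<sigma> i \<le> n" "\<sigma> i \<noteq> \<sigma> 0" "\<sigma> 0 \<in> \<sigma> ` {0..r}" "\<sigma> i \<in> \<sigma> ` {0..r}"
    "card ({..n} - \<sigma> ` {0..r}) = k" if "\<sigma> \<in> Sig r n" "i \<in> {1..r}" for \<sigma> i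
  proof -
    show "\<sigma> 0 \<in> \<sigma> ` {0..r}" "\<sigma> i \<in> \<sigma> ` {0..r}" using that(2) by auto
    then show "\<sigma> 0 \<le> n" "\<sigma> i \<le> n" using Sig_range(2)[OF that(1)] by blast+
    show "\<sigma> i \<noteq> \<sigma> 0" using that(2) inj_onD[OF Sig_range(1)[OF that(1)], of i 0] by auto
    show "card ({..n} - \<sigma> ` {0..r}) = k"
      using Sig_range(2,3)[OF that(1)] r by (subst card_Diff_subset) auto
  qed
  have x_in: "x ` I \<subseteq> XX k"
  proof -
    have "x (\<sigma>, i) \<in> XX k" if "\<sigma> \<in> Sig r n" "i \<in> {1..r}" for \<sigma> i
    proof -
      have "{..n} - \<sigma> ` {0..r} \<subseteq> {..n} - {\<sigma> 0, \<sigma> i}" using Sig(4,5)[OF that] by blast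
      from tensor_dlam_in_XX[OF this Sig(1,2,3)[OF that]] show ?thesis
        unfolding x_eq Sig(6)[OF that] .
    qed
    then show ?thesis by (auto simp: I_def)
  qed
  have nz: "?b (x p) (y q) \<noteq> 0 \<longleftrightarrow> p = q" if pq: "p \<in> I" "q \<in> I" for p q
  proof -
    obtain \<sigma> i where p: "p = (\<sigma>, i)" "\<sigma> \<in> Sig r n" "i \<in> {1..r}"
      using pq(1) unfolding I_def by blast
    obtain \<tau> j where q: "q = (\<tau>, j)" "\<tau> \<in> Sig r n" "j \<in> {1..r}"
      using pq(2) unfolding I_def by blast
    let ?A = "{..n} - \<sigma> ` {0..r}" and ?B = "\<tau> ` {0..r} - {\<tau> j}" and ?C = "{..n} - {\<sigma> 0, \<sigma> i}"
    have cA: "card ?A = k" by (rule Sig(6)[OF p(2,3)])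
    have cB: "card ?B = r"
      by (simp only: card_Diff_singleton[OF Sig(5)[OF q(2,3)]] Sig_range(3)[OF q(2)] add_diff_cancel_right')
    have "card ?C = card {..n} - card {\<sigma> 0, \<sigma> i}"
      by (rule card_Diff_subset) (simp_all add: Sig(1,2)[OF p(2,3)])
    then have cC: "card ?C = n - 1" using Sig(3)[OF p(2,3)] by simp
    have c1: "card {\<tau> j} = 1" by simp
    have e: "?b (x p) (y q) = form_inner (card ?A) (dlam lam ?A) (hodge_star (card ?B) (dlam lam ?B))
        * form_inner (card ?C) (dlam lam ?C) (hodge_star (card {\<tau> j}) (dlam lam {\<tau> j}))"
      by (simp only: p(1) q(1) x_eq y_def prod.case biform_inner_tensor cA cB cC c1)
    have u: "form_inner (card ?A) (dlam lam ?A) (hodge_star (card ?B) (dlam lam ?B)) \<noteq> 0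
        \<longleftrightarrow> ?A \<inter> ?B = {}"
    proof (rule form_inner_dlam_star)
      show "?B \<subseteq> {..n}" using Sig_range(2)[OF q(2)] by blast
      show "card ?A + card ?B = n" by (simp only: cA cB r(1))
    qed blast
    have v: "form_inner (card ?C) (dlam lam ?C) (hodge_star (card {\<tau> j}) (dlam lam {\<tau> j})) \<noteq> 0
        \<longleftrightarrow> ?C \<inter> {\<tau> j} = {}"
    proof (rule form_inner_dlam_star)
      show "{\<tau> j} \<subseteq> {..n}" using Sig(2)[OF q(2,3)] by simp
      show "card ?C + card {\<tau> j} = n" unfolding cC c1 using assms(2) by simp
    qed blast
    have "?b (x p) (y q) \<noteq> 0 \<longleftrightarrow> ?A \<inter> ?B = {} \<and> ?C \<inter> {\<tau> j} = {}"
      unfolding e mult_eq_0_iff de_Morgan_disj u v ..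
    also have "\<dots> \<longleftrightarrow> p = q"
    proof
      assume *: "?A \<inter> ?B = {} \<and> ?C \<inter> {\<tau> j} = {}"
      then have \<tau>j: "\<tau> j = \<sigma> 0 \<or> \<tau> j = \<sigma> i" using Sig(2)[OF q(2,3)] by blast
      then have in_\<sigma>: "\<tau> j \<in> \<sigma> ` {0..r}" using Sig(4,5)[OF p(2,3)] by metis
      \<comment> \<open>The first disjointness puts the range of \<tau> without
        \<open>\<tau> j\<close> inside that of \<sigma>. Since \<open>\<tau> j\<close> lies there
        too and the sizes agree, the ranges coincide.\<close>
      have "R' \<subseteq> R" if "(N - R) \<inter> (R' - {t}) = {}" "t \<in> R" "R' \<subseteq> N" for N R R' :: "nat set" and t
        using that by blast
      from this[OF conjunct1[OF *] in_\<sigma> Sig_range(2)[OF q(2)]]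
      have "\<tau> ` {0..r} = \<sigma> ` {0..r}"
        by (rule card_subset_eq[rotated]) (simp_all only: finite_imageI finite_atLeastAtMost
            Sig_range(3)[OF p(2)] Sig_range(3)[OF q(2)])
      then have eq: "\<sigma> = \<tau>" using Sig_eqI[OF p(2) q(2)] by simp
      \<comment> \<open>As \<open>j\<close> is at least 1, injectivity excludes the alternative
        \<open>\<sigma> 0\<close>.\<close>
      then have "\<sigma> j = \<sigma> i" using \<tau>j Sig(3)[OF q(2,3)] by metis
      then have "j = i" by (rule inj_onD[OF Sig_range(1)[OF p(2)]]) (use p(3) q(3) in auto)
      then show "p = q" using p(1) q(1) eq by simp
    next
      assume "p = q"
      then have eqs: "\<sigma> = \<tau>" "i = j" using p(1) q(1) by simp_all
      have "(N - R) \<inter> (R - {t}) = {} \<and> (N - {w, t}) \<inter> {t} = {}" for N R :: "nat set" and t w by blast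
      then show "?A \<inter> ?B = {} \<and> ?C \<inter> {\<tau> j} = {}" unfolding eqs .
    qed
    finally show ?thesis .
  qed
  have det: "\<omega> = 0" if \<omega>: "\<omega> \<in> XX k" and 0: "\<And>p. p \<in> I \<Longrightarrow> ?b \<omega> (y p) = 0" for \<omega>
  proof (rule XX_eq_0[OF \<omega> assms(3,4)])
    fix \<tau> m assume *: "\<tau> \<subseteq> {..n}" "card \<tau> = n - k + 1" "m \<in> \<tau>" "m \<noteq> Min \<tau>"
    obtain \<sigma> i where "\<sigma> \<in> Sig r n" "i \<in> {1..r}" "\<sigma> ` {0..r} = \<tau>" "\<sigma> i = m"
      using Sig_obtain[of \<tau> n r m] * r by auto
    then show "?b \<omega> (tensor (hodge_star (n - k) (dlam lam (\<tau> - {m}))) (hodge_star 1 (dlam lam {m}))) = 0"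
      using 0[of "(\<sigma>, i)"] r by (simp add: I_def y_def)
  qed
  have bx: "is_basis_of (x ` I) (XX k)"
    by (rule biorthogonal_basis[where b = "\<lambda>p \<omega>. ?b \<omega> (y p)", OF subspace_XX finI x_in linear_biform_inner nz det])
  have inj_x: "inj_on x I"
    by (rule biorthogonal_independent(1)[where b = "\<lambda>p \<omega>. ?b \<omega> (y p)", OF linear_biform_inner nz])
  have span_x: "finite (x ` I)" "span (x ` I) = XX k" using bx finI by (auto simp: is_basis_of_def)
  have z_in: "z p \<in> XX k" for p unfolding z_eq by (rule proj_XX(1)[OF span_x])
  have nz': "?b (x p) (z q) \<noteq> 0 \<longleftrightarrow> p = q" if "p \<in> I" "q \<in> I" for p q
  proof -
    have "x p \<in> XX k" using x_in that(1) by blast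
    then have "?b (x p) (z q) = ?b (x p) (y q)"
      unfolding z_eq assms(1) by (rule proj_XX(2)[OF span_x])
    then show ?thesis using nz[OF that] by simp
  qed
  have l: "linear (?b (x p))" for p
  proof -
    have "?b (x p) = (\<lambda>\<omega>. ?b \<omega> (x p))" by (rule ext) (rule biform_inner_commute)
    then show ?thesis by (simp only: linear_biform_inner)
  qed
  have nz'': "?b (x q) (z p) \<noteq> 0 \<longleftrightarrow> p = q" if "p \<in> I" "q \<in> I" for p q using nz'[OF that(2,1)] by blast
  \<comment> \<open>Now the pairings with the first family serve as the functionals: they give
    independence, and injectivity of both parametrisations over \<open>I\<close> gives the right
    cardinality.\<close>
  have bz: "is_basis_of (z ` I) (XX k)"
  proof (rule independent_same_card_basis[OF bx span_x(1)])
    show "independent (z ` I)"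
      by (rule biorthogonal_independent(2)[where b = "\<lambda>p. ?b (x p)", OF l nz''])
    have "inj_on z I"
      by (rule biorthogonal_independent(1)[where b = "\<lambda>p. ?b (x p)", OF l nz''])
    then show "card (z ` I) = card (x ` I)" using inj_x by (simp add: card_image)
  qed (use z_in in auto)
  have pairs: "(\<lambda>(\<sigma>, i). f \<sigma> i) ` I = {f \<sigma> i | \<sigma> i. \<sigma> \<in> Sig (n - k) n \<and> i \<in> {1..n - k}}"
    for f :: "(nat \<Rightarrow> nat) \<Rightarrow> nat \<Rightarrow> (real^'n::_) biform"
    unfolding I_def r(2) by force
  have pairing: "?b (phi k lam \<sigma> i) (psi k lam \<tau> j) \<noteq> 0 \<longleftrightarrow> \<sigma> = \<tau> \<and> i = j"
    if "\<sigma> \<in> Sig (n - k) n" "\<tau> \<in> Sig (n - k) n" "i \<in> {1..n - k}" "j \<in> {1..n - k}" for \<sigma> \<tau> i j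
  proof -
    have "(\<sigma>, i) \<in> I" "(\<tau>, j) \<in> I" using that unfolding I_def r(2) by blast+
    from nz'[OF this] show ?thesis by (simp add: x_def z_def)
  qed
  show ?thesis
    using bx bz pairing unfolding x_def z_def pairs by blast
qed

end
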